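(* For every $r=3t-1$ with $r=26$ or $r\ge44$ (i.e. $t=9$ or $t\ge15$), there exists a binary linear $[n,n-r,3]_2 3,2$ code with $n=819\cdot2^{(r-26)/3}-1$. Consequently $\ell_2(r,3)\le 819\cdot2^{(r-26)/3}-1$ for these $r$, and the covering densities $\mu=2^{-r}\sum_{i=0}^{3}\binom ni$ of these codes tend to $819^3/(3\cdot2^{27})\approx1.3643$ as $r\to\infty$.
   Context: An $[n,n-r,d]_2R,\ell$ code is a binary linear code of length $n$, codimension $r$, minimum distance $d$, covering radius $R$ (smallest $R$ such that every vector of $\mathbb{F}_2^r$ is a sum of at most $R$ columns of a parity-check matrix $H$), such that some parity-check matrix $H$ admits an $(R,\ell)$-partition: a partition of its columns into nonempty subsets such that every vector of $\mathbb{F}_2^r$ (including zero) is the sum of at least $\ell$ and at most $R$ columns lying in pairwise distinct subsets. $\ell_2(r,R)$ is the smallest length of a binary linear code of codimension $r$ and covering radius $R$. *)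

theory Defs
  imports Complex_Main "HOL-Library.Z2" "HOL-Library.Function_Algebras" "HOL-Library.Disjoint_Sets"
begin

text \<open>Binary vectors of F_2^r are functions nat => bit vanishing at indices >= r.
  A binary parity-check matrix with r rows and n columns is given by its columns
  H j (for j < n), each a vector of F_2^r.  A binary word of length n is identified
  with its support, a subset of {..<n}; its Hamming weight is the cardinality.\<close>

definition bvec :: "nat \<Rightarrow> (nat \<Rightarrow> bit) set" where
  "bvec r = {v. \<forall>i\<ge>r. v i = 0}"

definition is_pcm :: "nat \<Rightarrow> nat \<Rightarrow> (nat \<Rightarrow> nat \<Rightarrow> bit) \<Rightarrow> bool" where
  "is_pcm r n H \<longleftrightarrow> (\<forall>j<n. H j \<in> bvec r)"

definition colsum :: "(nat \<Rightarrow> nat \<Rightarrow> bit) \<Rightarrow> nat set \<Rightarrow> (nat \<Rightarrow> bit)" where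
  "colsum H S = (\<Sum>j\<in>S. H j)"

definition code_of :: "nat \<Rightarrow> (nat \<Rightarrow> nat \<Rightarrow> bit) \<Rightarrow> nat set set" where
  "code_of n H = {x. x \<subseteq> {..<n} \<and> colsum H x = 0}"

definition has_min_dist :: "nat \<Rightarrow> (nat \<Rightarrow> nat \<Rightarrow> bit) \<Rightarrow> nat \<Rightarrow> bool" where
  "has_min_dist n H d \<longleftrightarrow>
     (\<exists>x\<in>code_of n H. x \<noteq> {} \<and> card x = d) \<and>
     (\<forall>x\<in>code_of n H. x \<noteq> {} \<longrightarrow> d \<le> card x)"

definition covers_within :: "nat \<Rightarrow> nat \<Rightarrow> (nat \<Rightarrow> nat \<Rightarrow> bit) \<Rightarrow> nat \<Rightarrow> bool" where
  "covers_within r n H R \<longleftrightarrow>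
     (\<forall>v\<in>bvec r. \<exists>S\<subseteq>{..<n}. card S \<le> R \<and> colsum H S = v)"

definition has_cov_radius :: "nat \<Rightarrow> nat \<Rightarrow> (nat \<Rightarrow> nat \<Rightarrow> bit) \<Rightarrow> nat \<Rightarrow> bool" where
  "has_cov_radius r n H R \<longleftrightarrow>
     covers_within r n H R \<and> (\<forall>R'<R. \<not> covers_within r n H R')"

definition is_Rl_partition ::
  "nat \<Rightarrow> nat \<Rightarrow> (nat \<Rightarrow> nat \<Rightarrow> bit) \<Rightarrow> nat \<Rightarrow> nat \<Rightarrow> nat set set \<Rightarrow> bool" where
  "is_Rl_partition r n H R l P \<longleftrightarrow> partition_on {..<n} P \<and>
     (\<forall>v\<in>bvec r. \<exists>S\<subseteq>{..<n}. l \<le> card S \<and> card S \<le> R \<and> colsum H S = v \<and>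
        (\<forall>B\<in>P. card (S \<inter> B) \<le> 1))"

text \<open>An [n,n-r,d]_2 R,l code, given by a parity-check matrix H with r rows.
  (Covering radius R implies that the columns span F_2^r, i.e. H has rank r,
  so the code has dimension n-r.)\<close>
definition is_code_Rl ::
  "nat \<Rightarrow> nat \<Rightarrow> nat \<Rightarrow> nat \<Rightarrow> nat \<Rightarrow> (nat \<Rightarrow> nat \<Rightarrow> bit) \<Rightarrow> bool" where
  "is_code_Rl n r d R l H \<longleftrightarrow> is_pcm r n H \<and> has_min_dist n H d \<and>
     has_cov_radius r n H R \<and> (\<exists>P. is_Rl_partition r n H R l P)"

definition ell2 :: "nat \<Rightarrow> nat \<Rightarrow> nat" where
  "ell2 r R = (LEAST n. \<exists>H. is_pcm r n H \<and> has_cov_radius r n H R)"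

end

theory Submission
  imports Defs "HOL-Library.Product_Plus" "HOL-Algebra.Algebraic_Closure_Type"
begin

text \<open>
  Davydov's concatenation: give each column \<open>h\<close> of a code of codimension \<open>r\<close> a point \<open>b h\<close> of the field
  \<open>K\<close> with \<open>2\<^sup>m\<close> elements and replace it by the columns \<open>(h, x, b x, b\<^sup>2 x)\<close>, \<open>x \<in> K\<close>. If \<open>v\<close> is a sum of three
  old columns with distinct points, every \<open>(v, u) \<in> F\<^sub>2\<^sup>r \<times> K\<^sup>3\<close> is a sum of three new columns because the
  Vandermonde system is solvable; if \<open>v\<close> is a sum of two, one further column \<open>(0, 0, 0, w)\<close> closes the gap.
  So a code of length \<open>n\<close> with a \<open>(3,2)\<close>-partition into at most \<open>2\<^sup>m\<close> classes yields one of length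
  \<open>(n + 1) 2\<^sup>m - 1\<close> and codimension \<open>r + 3 m\<close>.

  The starting code of length 818 = 23 * 32 + 31 + 51 and codimension 26 = 11 + 15 comes from the same
  construction over the field with 32 elements, applied to the perfect Golay code. There single columns
  and zero have to be covered as well, which is done by a set \<open>D\<close> of 51 points in \<open>K\<^sup>2\<close>, placed as
  \<open>(0, d, 0)\<close>: every nonzero vector of \<open>K\<^sup>2\<close> is a sum of two points of \<open>D\<close> from different ones of 11 classes,
  and \<open>D\<close> meets each of the 23 lines of slope \<open>b h\<close>. With 23 classes for the Golay columns and 3 for the
  columns \<open>(0, 0, 0, w)\<close> this gives a \<open>(3,2)\<close>-partition into 37 \<open>\<le>\<close> 64 classes.
\<close>

section \<open>The finite fields of characteristic two\<close>

type_synonym f2bar = "bit alg_closure"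

text \<open>The roots of \<open>x ^ 2 ^ m = x\<close> in an algebraic closure of the field with two
  elements form its subfield of order \<open>2 ^ m\<close>. Realising every \<open>gf m\<close>
  inside the one type \<open>f2bar\<close> lets \<open>m\<close> vary freely.\<close>

definition gf :: "nat \<Rightarrow> f2bar set" where
  "gf m = {x. x ^ 2 ^ m = x}"

lemma add_self [simp]: "(x::f2bar) + x = 0"
proof -
  have "(1::f2bar) + 1 = to_ac (1 + 1)"
    by (simp only: to_ac_add to_ac_1)
  then have "(1::f2bar) + 1 = 0"
    by simp
  then show ?thesis
    by (metis distrib_right mult_1 mult_zero_left)
qed

lemma add_self_left [simp]: "(x::f2bar) + (x + y) = y"
  by (metis add_self add.assoc add.left_neutral)

lemma uminus_f2bar [simp]: "- (x::f2bar) = x"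
  by (rule minus_unique) simp

text \<open>Rewriting differences to sums lets closure of \<open>gf m\<close> under addition serve
  for subtraction too.\<close>

lemma minus_f2bar [simp]: "(x::f2bar) - y = x + y"
  by (metis diff_conv_add_uminus uminus_f2bar)

lemma two_f2bar [simp]: "(2::f2bar) = 0"
  by (metis add_self one_add_one)

lemma add_eq_0_f2bar [simp]: "(x::f2bar) + y = 0 \<longleftrightarrow> x = y"
  by (metis add_self add_self_left add.right_neutral)

lemma square_add: "((x::f2bar) + y)\<^sup>2 = x\<^sup>2 + y\<^sup>2"
  by (simp add: power2_sum)

lemma frobenius_add: "((x::f2bar) + y) ^ 2 ^ m = x ^ 2 ^ m + y ^ 2 ^ m"
  by (induction m) (simp_all add: power_mult mult.commute[of 2] square_add)

lemma gf_0 [simp]: "0 \<in> gf m"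
  and gf_1 [simp]: "1 \<in> gf m"
  by (simp_all add: gf_def)

lemma gf_add [intro]: "x \<in> gf m \<Longrightarrow> y \<in> gf m \<Longrightarrow> x + y \<in> gf m"
  and gf_mult [intro]: "x \<in> gf m \<Longrightarrow> y \<in> gf m \<Longrightarrow> x * y \<in> gf m"
  and gf_divide [intro]: "x \<in> gf m \<Longrightarrow> y \<in> gf m \<Longrightarrow> x / y \<in> gf m"
  by (simp_all add: gf_def frobenius_add power_mult_distrib power_divide)

lemma gf_power [intro]: "x \<in> gf m \<Longrightarrow> x ^ n \<in> gf m"
  by (induction n) auto

text \<open>\<open>X ^ 2 ^ m - X\<close> splits into linear factors over the closure. A repeated
  root would also be a root of the derivative, which is constantly 1; so the number of roots equals
  the degree.\<close>

lemma card_gf: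
  assumes "m > 0"
  shows "card (gf m) = 2 ^ m"
proof -
  define p :: "f2bar poly" where "p = Polynomial.monom 1 (2 ^ m) - Polynomial.monom 1 1"
  have m1: "(2::nat) ^ m > 1"
    by (rule one_less_power) (use assms in auto)
  have deg: "Polynomial.degree p = 2 ^ m"
    unfolding p_def diff_conv_add_uminus using m1
    by (subst degree_add_eq_left) (simp_all add: degree_monom_eq)
  then have p0: "p \<noteq> 0"
    by auto
  have root: "poly p x = 0 \<longleftrightarrow> x \<in> gf m" for x
    by (simp add: p_def gf_def poly_monom flip: minus_f2bar)
  \<comment> \<open>The leading term contributes nothing because \<open>2 ^ m\<close> is even for
    positive \<open>m\<close>, and \<open>- 1 = 1\<close>.\<close>
  have der: "poly (pderiv p) x = 1" for x
    using assms by (simp add: p_def pderiv_diff pderiv_monom poly_monom)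
  obtain A where A: "size A = Polynomial.degree p"
    "p = smult (Polynomial.lead_coeff p) (\<Prod>x\<in>#A. [:-x, 1:])"
    using alg_closed_imp_factorization[OF p0] by blast
  have lc: "Polynomial.lead_coeff p \<noteq> 0"
    using p0 by simp
  have "poly (\<Prod>x\<in>#A. [:-x, 1:]) y = 0 \<longleftrightarrow> y \<in># A" for y
    by (induction A) (auto simp flip: distrib_right)
  then have "set_mset A = gf m"
    using root lc A(2) by (metis poly_smult mult_eq_0_iff subsetI subset_antisym)
  moreover have "card (set_mset A) = size A"
  proof (rule ccontr)
    assume "card (set_mset A) \<noteq> size A"
    then have "\<not> (\<forall>x\<in>set_mset A. count A x = 1)"
      using size_multiset_overloaded_eq[of A] by (metis card_eq_sum sum.cong)
    then obtain x where x: "count A x \<noteq> 1" "x \<in># A"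
      by blast
    then have "count A x \<ge> 2"
      by (metis One_nat_def count_greater_zero_iff Suc_leI le_neq_implies_less numeral_2_eq_2)
    then have "replicate_mset 2 x \<subseteq># A"
      by (simp add: count_le_replicate_mset_subset_eq)
    then obtain B where "A = replicate_mset 2 x + B"
      by (metis subset_mset.add_diff_inverse)
    then have "A = add_mset x (add_mset x B)"
      by (simp add: numeral_2_eq_2)
    then have "(\<Prod>x\<in>#A. [:-x, 1:]) = [:-x, 1:]\<^sup>2 * (\<Prod>x\<in>#B. [:-x, 1:])"
      by (simp only: image_mset_add_mset prod_mset.add_mset power2_eq_square mult.assoc)
    then have "[:-x, 1:]\<^sup>2 dvd p"
      using A(2) by (metis dvd_smult dvd_triv_left)
    then obtain q where "p = [:-x, 1:] * ([:-x, 1:] * q)"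
      unfolding dvd_def power2_eq_square mult.assoc ..
    then have "poly (pderiv p) x = 0"
      by (simp only: pderiv_mult poly_add poly_mult) simp
    then show False
      using der by simp
  qed
  ultimately show ?thesis
    using A(1) deg by simp
qed

lemma finite_gf: "m > 0 \<Longrightarrow> finite (gf m)"
  by (rule card_ge_0_finite) (simp add: card_gf)

section \<open>Finite groups of exponent two\<close>

text \<open>Such a \<open>V\<close> is a vector space of dimension \<open>m\<close> over the field
  with two elements. Expressed through addition alone, the notion fits \<open>bvec\<close>,
  \<open>gf\<close> and their products alike.\<close>

definition elem2 :: "'a::ab_group_add set \<Rightarrow> nat \<Rightarrow> bool" where
  "elem2 V m \<longleftrightarrow> 0 \<in> V \<and> (\<forall>x\<in>V. \<forall>y\<in>V. x + y \<in> V) \<and> (\<forall>x\<in>V. x + x = 0) \<and> card V = 2 ^ m"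

lemma bit_fun_add_self [simp]: "(v :: nat \<Rightarrow> bit) + v = 0"
proof
  fix i show "(v + v) i = 0 i" by (cases "v i") auto
qed

lemma card_bvec: "card (bvec m) = 2 ^ m"
proof -
  have "bij_betw (\<lambda>v. {i. v i = 1}) (bvec m) (Pow {..<m})"
  proof (rule bij_betwI[where g = "\<lambda>S i. of_bool (i \<in> S)"])
    show "(\<lambda>v. {i. v i = 1}) \<in> bvec m \<rightarrow> Pow {..<m}"
      by (auto simp: bvec_def) (metis linorder_not_less zero_neq_one)
    show "(\<lambda>S i. of_bool (i \<in> S)) \<in> Pow {..<m} \<rightarrow> bvec m"
      by (auto simp: bvec_def)
    fix v :: "nat \<Rightarrow> bit"
    show "(\<lambda>i. of_bool (i \<in> {i. v i = 1})) = v"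
    proof
      fix i show "of_bool (i \<in> {i. v i = 1}) = v i" by (cases "v i") auto
    qed
  qed auto
  then show ?thesis
    by (metis bij_betw_same_card card_Pow card_lessThan finite_lessThan)
qed

lemma finite_bvec: "finite (bvec m)"
  by (rule card_ge_0_finite) (simp add: card_bvec)

lemma bvec_add: "v \<in> bvec m \<Longrightarrow> w \<in> bvec m \<Longrightarrow> v + w \<in> bvec m"
  by (simp add: bvec_def)

lemma elem2_bvec: "elem2 (bvec m) m"
  by (simp add: elem2_def card_bvec) (simp add: bvec_def)

lemma elem2_gf: "m > 0 \<Longrightarrow> elem2 (gf m) m"
  by (auto simp add: elem2_def card_gf)

lemma elem2_Times: "elem2 V m \<Longrightarrow> elem2 W n \<Longrightarrow> elem2 (V \<times> W) (m + n)"
  by (simp add: elem2_def zero_prod_def card_cartesian_product power_add)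

text \<open>A basis is chosen one vector at a time: while \<open>k < m\<close>, the image of
  \<open>bvec k\<close> is too small to fill \<open>V\<close>, and a missed element \<open>x\<close>
  becomes the image of the next unit vector.\<close>

lemma elem2_ex_inj:
  assumes V: "elem2 V m" and "k \<le> m"
  shows "\<exists>\<psi>. inj_on \<psi> (bvec k) \<and> \<psi> ` bvec k \<subseteq> V \<and>
           (\<forall>v\<in>bvec k. \<forall>w\<in>bvec k. \<psi> (v + w) = \<psi> v + \<psi> w)"
  using \<open>k \<le> m\<close>
proof (induction k)
  case 0
  have "bvec 0 = {0}" by (auto simp: bvec_def)
  then show ?case
    using V by (intro exI[of _ "\<lambda>_. 0"]) (auto simp: elem2_def)
next
  case (Suc k)
  from V have V0: "0 \<in> V" and Va: "\<And>x y. x \<in> V \<Longrightarrow> y \<in> V \<Longrightarrow> x + y \<in> V"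
    and Vs: "\<And>x. x \<in> V \<Longrightarrow> x + x = 0"
    by (auto simp: elem2_def)
  obtain \<psi> where \<psi>: "inj_on \<psi> (bvec k) \<and> \<psi> ` bvec k \<subseteq> V \<and>
      (\<forall>v\<in>bvec k. \<forall>w\<in>bvec k. \<psi> (v + w) = \<psi> v + \<psi> w)"
    using Suc.IH[OF Suc_leD[OF Suc.prems]] ..
  then have inj: "inj_on \<psi> (bvec k)" and im: "\<psi> ` bvec k \<subseteq> V"
    by iprover+
  have add: "\<psi> (v + w) = \<psi> v + \<psi> w" if "v \<in> bvec k" "w \<in> bvec k" for v w
    using \<psi> that by metis
  have "card (\<psi> ` bvec k) < card V"
    using inj V Suc.prems by (simp add: card_image card_bvec elem2_def)
  then obtain x where x: "x \<in> V" "x \<notin> \<psi> ` bvec k"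
    by (metis card_mono finite_imageI finite_bvec linorder_not_less subsetI)
  define r :: "(nat \<Rightarrow> bit) \<Rightarrow> nat \<Rightarrow> bit" where "r v = v(k := 0)" for v
  define s where "s v = (if v k = (1::bit) then x else 0)" for v :: "nat \<Rightarrow> bit"
  have r: "r v \<in> bvec k" if "v \<in> bvec (Suc k)" for v
    using that by (simp add: r_def bvec_def)
  have r_add: "r (v + w) = r v + r w" for v w
    by (auto simp: r_def)
  have s_add: "s (v + w) = s v + s w" for v w
    using Vs[OF x(1)] by (cases "v k"; cases "w k") (auto simp: s_def)
  have sV: "s v \<in> V" for v
    using V0 x by (simp add: s_def)
  let ?f = "\<lambda>v. \<psi> (r v) + s v"
  have "inj_on ?f (bvec (Suc k))"
  proof (rule inj_onI)
    fix v w assume vw: "v \<in> bvec (Suc k)" "w \<in> bvec (Suc k)" "?f v = ?f w"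
    \<comment> \<open>The left side lies in the image of \<open>\<psi>\<close>, which misses
      \<open>x\<close>; the right side is \<open>0\<close> or \<open>x\<close>. Hence both are
      zero.\<close>
    have 1: "\<psi> (r v + r w) = s v + s w"
    proof -
      have "\<psi> (r w) \<in> V"
        using im r vw by blast
      then have 0: "s v + s v = 0" "\<psi> (r w) + \<psi> (r w) = 0"
        using Vs sV by auto
      have "\<psi> (r v) + \<psi> (r w) = (\<psi> (r v) + s v) + (s v + \<psi> (r w))"
        using 0(1) by (simp add: add.assoc flip: add.assoc[of "s v" "s v"])
      also have "\<dots> = (\<psi> (r w) + \<psi> (r w)) + (s v + s w)"
        unfolding vw(3) by (simp only: ac_simps)
      finally have "\<psi> (r v) + \<psi> (r w) = s v + s w"
        using 0(2) by simp
      then show ?thesis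
        using add r vw by simp
    qed
    have "r v + r w \<in> bvec k"
      using r vw by (simp add: bvec_add)
    moreover have "s v + s w \<in> {0, x}"
      using Vs[OF x(1)] by (simp add: s_def)
    ultimately have s0: "s v + s w = 0"
      using 1 x by (metis imageI insertE singletonD)
    moreover have z: "0 \<in> bvec k" by (simp add: bvec_def)
    then have "\<psi> 0 = 0"
      using add[OF z z] by simp
    ultimately have "r v + r w = 0"
      using 1 inj z \<open>r v + r w \<in> bvec k\<close> by (metis inj_onD)
    have "r v = r w"
    proof
      fix i show "r v i = r w i"
        using fun_cong[OF \<open>r v + r w = 0\<close>, of i] by (cases "r v i"; cases "r w i") auto
    qed
    moreover have "x \<noteq> 0"
      using imageI[OF z, of \<psi>] x(2) unfolding \<open>\<psi> 0 = 0\<close> by blast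
    then have "v k = w k"
      using s0 by (cases "v k"; cases "w k") (auto simp: s_def)
    ultimately show "v = w"
      unfolding r_def by (metis fun_upd_triv fun_upd_upd)
  qed
  moreover have "?f ` bvec (Suc k) \<subseteq> V"
    using im r sV Va by blast
  moreover have "?f (v + w) = ?f v + ?f w" if "v \<in> bvec (Suc k)" "w \<in> bvec (Suc k)" for v w
    using that by (simp add: r_add s_add add r algebra_simps)
  ultimately show ?case
    by blast
qed

text \<open>For \<open>k = m\<close> the additive injection is onto by counting. Its inverse carries
  covering sets built from field elements back to binary vectors.\<close>

lemma elem2_iso_bvec:
  assumes "elem2 V m"
  obtains \<phi> where "bij_betw \<phi> V (bvec m)" "\<And>x y. x \<in> V \<Longrightarrow> y \<in> V \<Longrightarrow> \<phi> (x + y) = \<phi> x + \<phi> y"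
proof -
  obtain \<psi> where \<psi>: "inj_on \<psi> (bvec m)" "\<psi> ` bvec m \<subseteq> V"
    and add: "\<And>v w. v \<in> bvec m \<Longrightarrow> w \<in> bvec m \<Longrightarrow> \<psi> (v + w) = \<psi> v + \<psi> w"
    using elem2_ex_inj[OF assms order_refl] by blast
  have cV: "card V = 2 ^ m" using assms by (simp add: elem2_def)
  then have "finite V" by (intro card_ge_0_finite) simp
  then have im: "\<psi> ` bvec m = V"
    using \<psi> cV by (intro card_subset_eq) (simp_all add: card_image card_bvec)
  then have bij: "bij_betw \<psi> (bvec m) V"
    using \<psi> by (simp add: bij_betw_def)
  let ?\<phi> = "the_inv_into (bvec m) \<psi>"
  show ?thesis
  proof (rule that[of ?\<phi>])
    show bi: "bij_betw ?\<phi> V (bvec m)"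
      by (rule bij_betw_the_inv_into[OF bij])
    fix x y assume "x \<in> V" "y \<in> V"
    then obtain v w where "v \<in> bvec m" "w \<in> bvec m" "x = \<psi> v" "y = \<psi> w"
      using im by blast
    then show "?\<phi> (x + y) = ?\<phi> x + ?\<phi> y"
      using \<psi>(1) bvec_add by (simp add: the_inv_into_f_f flip: add)
  qed
qed

section \<open>Covering sets\<close>

text \<open>A (3,2)-partition in coordinate-free form: \<open>C\<close> is the set of columns, the
  fibres of \<open>c\<close> are the classes, and \<open>inj_on c T\<close> puts the summands into
  distinct classes.\<close>

definition cover23 :: "'a::ab_group_add set \<Rightarrow> 'a set \<Rightarrow> ('a \<Rightarrow> 'c) \<Rightarrow> bool" where
  "cover23 V C c \<longleftrightarrow> C \<subseteq> V \<and> finite C \<and>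
     (\<forall>v\<in>V. \<exists>T\<subseteq>C. card T \<in> {2, 3} \<and> \<Sum>T = v \<and> inj_on c T)"

lemma cover23E:
  assumes "cover23 V C c" "v \<in> V"
  obtains T where "T \<subseteq> C" "card T \<in> {2, 3}" "\<Sum>T = v" "inj_on c T"
proof -
  have "\<forall>v\<in>V. \<exists>T\<subseteq>C. card T \<in> {2, 3} \<and> \<Sum>T = v \<and> inj_on c T"
    using assms(1) unfolding cover23_def by (elim conjE)
  from bspec[OF this assms(2)] show thesis
    using that by (elim exE conjE)
qed

lemma additive_sum:
  assumes "elem2 V m" "\<And>x y. x \<in> V \<Longrightarrow> y \<in> V \<Longrightarrow> \<phi> (x + y) = \<phi> x + \<phi> y"
    and "finite T" "T \<subseteq> V"
  shows "\<Sum>T \<in> V \<and> \<phi> (\<Sum>T) = (\<Sum>x\<in>T. (\<phi> x :: 'b::ab_group_add))"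
  using assms(3,4)
proof (induction T rule: finite_induct)
  case empty
  have "0 \<in> V" using assms(1) by (simp add: elem2_def)
  moreover have "\<phi> 0 = 0" using assms(2)[OF \<open>0 \<in> V\<close> \<open>0 \<in> V\<close>] by simp
  ultimately show ?case by simp
next
  case (insert x T)
  then have "x \<in> V" "\<Sum>T \<in> V" by auto
  moreover from this have "x + \<Sum>T \<in> V" using assms(1) by (simp add: elem2_def)
  ultimately show ?case using insert by (simp add: assms(2))
qed

lemma cover23_image:
  assumes V: "elem2 V m" and C: "cover23 V C c" and bij: "bij_betw \<phi> V W"
    and add: "\<And>x y. x \<in> V \<Longrightarrow> y \<in> V \<Longrightarrow> \<phi> (x + y) = \<phi> x + \<phi> y"
  shows "cover23 W (\<phi> ` C) (\<lambda>w. c (the_inv_into V \<phi> w))"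
  unfolding cover23_def
proof (intro conjI ballI)
  have CV: "C \<subseteq> V" "finite C" using C by (auto simp: cover23_def)
  have inj: "inj_on \<phi> V" "\<phi> ` V = W" using bij by (auto simp: bij_betw_def)
  show "\<phi> ` C \<subseteq> W" "finite (\<phi> ` C)" using CV inj by auto
  fix w assume "w \<in> W"
  then obtain v where v: "v \<in> V" "w = \<phi> v" using inj by blast
  obtain T where T: "T \<subseteq> C" "card T \<in> {2, 3}" "\<Sum>T = v" "inj_on c T"
    using C v(1) by (rule cover23E)
  have TV: "T \<subseteq> V" "finite T" using T CV finite_subset by auto
  have injT: "inj_on \<phi> T" using inj TV inj_on_subset by blast
  have inv: "the_inv_into V \<phi> (\<phi> x) = x" if "x \<in> T" for x
    using that TV by (auto intro: the_inv_into_f_f[OF inj(1)])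
  show "\<exists>T'\<subseteq>\<phi> ` C. card T' \<in> {2, 3} \<and> \<Sum>T' = w \<and> inj_on (\<lambda>w. c (the_inv_into V \<phi> w)) T'"
  proof (intro exI conjI)
    show "\<phi> ` T \<subseteq> \<phi> ` C" using T by blast
    show "card (\<phi> ` T) \<in> {2, 3}" using T injT by (simp add: card_image)
    show "\<Sum>(\<phi> ` T) = w"
      using additive_sum[OF V add TV(2,1)] T(3) v injT by (simp add: sum.reindex)
    show "inj_on (\<lambda>w. c (the_inv_into V \<phi> w)) (\<phi> ` T)"
      using T(4) by (auto simp: inj_on_def inv)
  qed
qed

section \<open>From covering sets to parity-check matrices\<close>

lemma bit_fun_eq_iff: "(v :: nat \<Rightarrow> bit) + w = 0 \<longleftrightarrow> v = w"
proof
  assume *: "v + w = 0"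
  show "v = w"
  proof
    fix i show "v i = w i"
      using fun_cong[OF *, of i] by (cases "v i"; cases "w i") auto
  qed
qed simp

text \<open>The out-of-range index \<open>n\<close> stands for an absent element, so pairs of
  indices up to \<open>n\<close> encode all these sets.\<close>

lemma card_le_2_subsets:
  fixes n :: nat
  assumes "S \<subseteq> {..<n}" "card S \<le> 2"
  shows "\<exists>i\<le>n. \<exists>j\<le>n. S = {i, j} \<inter> {..<n}"
proof -
  have "finite S" by (rule finite_subset[OF assms(1)]) simp
  consider "card S = 0" | "card S = 1" | "card S = 2" using assms(2) by linarith
  then show ?thesis
  proof cases
    case 1
    then have "S = {n, n} \<inter> {..<n}" using \<open>finite S\<close> by simp
    then show ?thesis by blast
  next
    case 2
    then obtain i where "S = {i}" by (rule card_1_singletonE)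
    then have "i \<le> n" "S = {i, n} \<inter> {..<n}" using assms(1) by auto
    then show ?thesis by blast
  next
    case 3
    then obtain i j where "S = {i, j}" by (auto simp: card_2_iff)
    then have "i \<le> n" "j \<le> n" "S = {i, j} \<inter> {..<n}" using assms(1) by auto
    then show ?thesis by blast
  qed
qed

text \<open>Columns are nonzero and distinct, so no codeword has weight 1 or 2, and the
  representation of zero must have weight 3. Covering radius below 3 is excluded by
  counting.\<close>

lemma code_of_cover23:
  assumes C: "cover23 (bvec r) C c" and n: "card C = n" and C0: "0 \<notin> C"
    and small: "(n + 1)\<^sup>2 < 2 ^ r"
  shows "\<exists>H. is_code_Rl n r 3 3 2 H"
proof -
  have CV: "C \<subseteq> bvec r" "finite C" using C by (auto simp: cover23_def)
  obtain H where H: "bij_betw H {..<n} C"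
    using ex_bij_betw_nat_finite[OF CV(2)] n by (auto simp: lessThan_atLeast0)
  have inj: "inj_on H {..<n}" and im: "H ` {..<n} = C" using H by (auto simp: bij_betw_def)
  have cover: "\<exists>S\<subseteq>{..<n}. card S \<in> {2, 3} \<and> colsum H S = v" if v: "v \<in> bvec r" for v
  proof -
    obtain T where T: "T \<subseteq> C" "card T \<in> {2, 3}" "\<Sum>T = v" "inj_on c T"
      using C v by (rule cover23E)
    obtain S where S: "S \<subseteq> {..<n}" "T = H ` S" using T(1) im by (metis subset_imageE)
    have "inj_on H S" using inj S(1) inj_on_subset by blast
    then show ?thesis
      using T S by (intro exI[of _ S]) (simp add: colsum_def card_image sum.reindex)
  qed
  have ge3: "3 \<le> card x" if x: "x \<subseteq> {..<n}" "colsum H x = 0" "x \<noteq> {}" for x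
  proof (rule ccontr)
    assume "\<not> 3 \<le> card x"
    moreover have "finite x" using x finite_subset by blast
    then have "card x \<noteq> 0" using x(3) by simp
    ultimately consider "card x = 1" | "card x = 2" by linarith
    then show False
    proof cases
      case 1
      then obtain i where "x = {i}" by (rule card_1_singletonE)
      then show False using x im C0 by (auto simp: colsum_def)
    next
      case 2
      then obtain i j where "x = {i, j}" "i \<noteq> j" by (auto simp: card_2_iff)
      then show False using x inj by (auto simp: colsum_def bit_fun_eq_iff inj_on_def)
    qed
  qed
  have "is_pcm r n H" using im CV by (auto simp: is_pcm_def)
  moreover have "has_min_dist n H 3"
  proof -
    have "0 \<in> bvec r" by (simp add: bvec_def)
    from cover[OF this] obtain S where S: "S \<subseteq> {..<n}" "card S \<in> {2, 3}" "colsum H S = 0"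
      by blast
    then have "S \<noteq> {}" by auto
    then have "card S = 3" using ge3[OF S(1,3)] S(2) by auto
    then show ?thesis
      using S \<open>S \<noteq> {}\<close> ge3 by (auto simp: has_min_dist_def code_of_def)
  qed
  moreover have "has_cov_radius r n H 3"
    unfolding has_cov_radius_def
  proof (intro conjI allI impI notI)
    show "covers_within r n H 3"
      unfolding covers_within_def
    proof
      fix v assume "v \<in> bvec r"
      from cover[OF this] obtain S where S: "S \<subseteq> {..<n}" "card S \<in> {2, 3}" "colsum H S = v"
        by blast
      then have "card S \<le> 3" by auto
      with S show "\<exists>S\<subseteq>{..<n}. card S \<le> 3 \<and> colsum H S = v" by blast
    qed
    fix R assume R: "R < (3::nat)" "covers_within r n H R"
    \<comment> \<open>Sums of at most two columns are indexed by (n + 1)^2 pairs, fewer than the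
      \<open>2 ^ r\<close> vectors.\<close>
    have "bvec r \<subseteq> (\<lambda>(i, j). colsum H ({i, j} \<inter> {..<n})) ` ({..n} \<times> {..n})"
    proof
      fix v assume "v \<in> bvec r"
      then obtain S where S: "S \<subseteq> {..<n}" "card S \<le> R" "colsum H S = v"
        using R by (auto simp: covers_within_def)
      then obtain i j where "i \<le> n" "j \<le> n" "S = {i, j} \<inter> {..<n}"
        using card_le_2_subsets[of S n] R(1) by auto
      then show "v \<in> (\<lambda>(i, j). colsum H ({i, j} \<inter> {..<n})) ` ({..n} \<times> {..n})"
        using S(3) by force
    qed
    then have "card (bvec r) \<le> card ({..n} \<times> {..n})"
      by (rule surj_card_le[rotated]) simp
    then show False using small by (simp add: card_bvec card_cartesian_product power2_eq_square)
  qed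
  \<comment> \<open>With single columns as classes, every set of columns meets each class at most
    once.\<close>
  moreover have "is_Rl_partition r n H 3 2 ((\<lambda>j. {j}) ` {..<n})"
    unfolding is_Rl_partition_def
  proof (intro conjI ballI)
    show "partition_on {..<n} ((\<lambda>j. {j}) ` {..<n})"
      by (auto simp: partition_on_def disjoint_def)
    fix v assume "v \<in> bvec r"
    from cover[OF this] obtain S where S: "S \<subseteq> {..<n}" "card S \<in> {2, 3}" "colsum H S = v"
      by blast
    have "card (S \<inter> {j}) \<le> 1" for j
      using card_mono[of "{j}" "S \<inter> {j}"] by simp
    then show "\<exists>S\<subseteq>{..<n}. 2 \<le> card S \<and> card S \<le> 3 \<and> colsum H S = v \<and>
        (\<forall>B\<in>(\<lambda>j. {j}) ` {..<n}. card (S \<inter> B) \<le> 1)"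
      using S by (intro exI[of _ S]) auto
  qed
  ultimately show ?thesis
    unfolding is_code_Rl_def by blast
qed

section \<open>Concatenation with a curve\<close>

definition curve :: "('a \<Rightarrow> f2bar) \<Rightarrow> 'a \<Rightarrow> f2bar \<Rightarrow> 'a \<times> f2bar \<times> f2bar \<times> f2bar" where
  "curve b h x = (h, x, b h * x, (b h)\<^sup>2 * x)"

definition curves :: "nat \<Rightarrow> ('a \<Rightarrow> f2bar) \<Rightarrow> 'a set \<Rightarrow> ('a \<times> f2bar \<times> f2bar \<times> f2bar) set" where
  "curves m b C = (\<lambda>(h, x). curve b h x) ` (C \<times> gf m)"

text \<open>Leaving out zero keeps the zero vector from being a column; this is the source of the
  \<open>- 1\<close> in the lengths.\<close>

definition axis :: "nat \<Rightarrow> ('a::zero \<times> f2bar \<times> f2bar \<times> f2bar) set" where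
  "axis m = (\<lambda>w. (0, 0, 0, w)) ` (gf m - {0})"

lemma vandermonde2:
  fixes a b u1 u2 :: "'a::field"
  assumes "a \<noteq> b"
  defines "x \<equiv> (u2 - b * u1) / (a - b)"
  shows "a * x + b * (u1 - x) = u2"
proof -
  have "(a - b) * x = u2 - b * u1" using assms by simp
  then show ?thesis by (simp add: algebra_simps)
qed

text \<open>Since \<open>b\<close> and \<open>c\<close> are the roots of
  \<open>X^2 - (b + c) X + b c\<close>, the combination
  \<open>u3 - (b + c) * u2 + b * c * u1\<close> eliminates \<open>y\<close> and \<open>z\<close> and
  leaves \<open>(a - b) * (a - c) * x\<close>. The rest is a system in two unknowns.\<close>

lemma vandermonde3:
  fixes a b c u1 u2 u3 :: "'a::field"
  assumes "a \<noteq> b" "a \<noteq> c" "b \<noteq> c"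
  defines "x \<equiv> (u3 - (b + c) * u2 + b * c * u1) / ((a - b) * (a - c))"
  defines "y \<equiv> ((u2 - a * x) - c * (u1 - x)) / (b - c)"
  defines "z \<equiv> u1 - x - y"
  shows "x + y + z = u1" "a * x + b * y + c * z = u2" "a\<^sup>2 * x + b\<^sup>2 * y + c\<^sup>2 * z = u3"
proof -
  show "x + y + z = u1" by (simp add: z_def)
  have *: "b * y + c * z = u2 - a * x"
    unfolding y_def z_def using vandermonde2[OF assms(3)] by simp
  then show "a * x + b * y + c * z = u2" by (simp add: algebra_simps)
  have **: "(a - b) * (a - c) * x = u3 - (b + c) * u2 + b * c * u1"
    using assms(1,2) by (simp add: x_def)
  have "b\<^sup>2 * y + c\<^sup>2 * z = (b + c) * (b * y + c * z) - b * c * (y + z)"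
    by (simp add: algebra_simps power2_eq_square)
  also have "y + z = u1 - x" by (simp add: z_def)
  finally have "a\<^sup>2 * x + b\<^sup>2 * y + c\<^sup>2 * z = (a - b) * (a - c) * x + (b + c) * u2 - b * c * u1"
    unfolding * by (simp add: algebra_simps power2_eq_square)
  then show "a\<^sup>2 * x + b\<^sup>2 * y + c\<^sup>2 * z = u3"
    unfolding ** by simp
qed

text \<open>Three summands leave a Vandermonde system in three unknowns. With two, the first two
  equations fix \<open>x\<close> and \<open>y\<close>, and a vector of \<open>axis m\<close> repairs
  the last coordinate. As \<open>0 \<notin> C\<close>, that vector differs from the curve points
  already in its first component, so \<open>fst\<close> can serve as labelling.\<close>

lemma sum_curves:
  assumes T: "T \<subseteq> C" "card T \<in> {2, 3}" "inj_on b T"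
    and C: "0 \<notin> C" "b ` C \<subseteq> gf m"
    and u: "u1 \<in> gf m" "u2 \<in> gf m" "u3 \<in> gf m"
  shows "\<exists>S \<subseteq> curves m b C \<union> axis m. card S \<in> {2, 3} \<and> \<Sum>S = (\<Sum>T, u1, u2, u3) \<and> inj_on fst S"
proof (cases "card T = 3")
  case True
  then obtain f g h where T': "T = {f, g, h}" "f \<noteq> g" "f \<noteq> h" "g \<noteq> h"
    by (auto simp: card_3_iff)
  then have b: "b f \<noteq> b g" "b f \<noteq> b h" "b g \<noteq> b h"
    using T(3) by (auto simp: inj_on_def)
  have fgh: "f \<in> C" "g \<in> C" "h \<in> C" "b f \<in> gf m" "b g \<in> gf m" "b h \<in> gf m"
    using T T' C by auto
  define x where "x = (u3 - (b g + b h) * u2 + b g * b h * u1) / ((b f - b g) * (b f - b h))"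
  define y where "y = ((u2 - b f * x) - b h * (u1 - x)) / (b g - b h)"
  define z where "z = u1 - x - y"
  note eqs = vandermonde3[OF b, of u3 u2 u1, folded x_def, folded y_def, folded z_def]
  have "x \<in> gf m" unfolding x_def minus_f2bar by (intro gf_divide gf_add gf_mult u fgh)
  moreover from this have "y \<in> gf m" unfolding y_def minus_f2bar by (intro gf_divide gf_add gf_mult u fgh)
  moreover have "z \<in> gf m" unfolding z_def minus_f2bar by (intro gf_add u calculation)
  ultimately have xyz: "x \<in> gf m" "y \<in> gf m" "z \<in> gf m" .
  then have "{curve b f x, curve b g y, curve b h z} \<subseteq> curves m b C \<union> axis m" (is "?S \<subseteq> _")
    using fgh xyz by (auto simp: curves_def)
  moreover have "card ?S = 3" "inj_on fst ?S"
    using T' by (auto simp: curve_def)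
  moreover have "\<Sum>?S = (\<Sum>T, u1, u2, u3)"
    using T' eqs by (simp add: curve_def algebra_simps)
  ultimately show ?thesis
    by (intro exI[of _ ?S]) simp
next
  case False
  then have "card T = 2" using T(2) by simp
  then obtain f g where T': "T = {f, g}" "f \<noteq> g"
    by (auto simp: card_2_iff)
  then have b: "b f \<noteq> b g"
    using T(3) by (auto simp: inj_on_def)
  have fg: "f \<in> C" "g \<in> C" "b f \<in> gf m" "b g \<in> gf m" "f \<noteq> 0" "g \<noteq> 0"
    using T T' C by auto
  define x where "x = (u2 - b g * u1) / (b f - b g)"
  define y where "y = u1 - x"
  \<comment> \<open>The defect in the last coordinate; if it vanishes, the two curve points already
    suffice.\<close>
  define w where "w = u3 - (b f)\<^sup>2 * x - (b g)\<^sup>2 * y"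
  have eqs: "x + y = u1" "b f * x + b g * y = u2" "(b f)\<^sup>2 * x + (b g)\<^sup>2 * y + w = u3"
    unfolding y_def w_def using vandermonde2[OF b, of u2 u1, folded x_def]
    by (simp_all only: diff_add_cancel add_diff_cancel add.commute[of x] add.commute[of _ "u3 - _"]) simp_all
  have x: "x \<in> gf m" unfolding x_def minus_f2bar by (intro gf_divide gf_add gf_mult u fg)
  then have y: "y \<in> gf m" unfolding y_def minus_f2bar using u by (intro gf_add)
  have w: "w \<in> gf m" unfolding w_def minus_f2bar using u fg x y by (intro gf_add gf_mult gf_power)
  let ?A = "{curve b f x, curve b g y}"
  have S0: "?A \<subseteq> curves m b C" "card ?A = 2" "inj_on fst ?A"
    "\<Sum>?A = (\<Sum>T, u1, u2, (b f)\<^sup>2 * x + (b g)\<^sup>2 * y)"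
    using T' fg x y eqs by (auto simp: curves_def curve_def algebra_simps)
  show ?thesis
  proof (cases "w = 0")
    case True
    then show ?thesis using S0 eqs by (intro exI[of _ ?A]) auto
  next
    case False
    let ?S = "insert (0, 0, 0, w) ?A"
    have "?S \<subseteq> curves m b C \<union> axis m" using S0 w False by (auto simp: axis_def)
    moreover have *: "(0, 0, 0, w) \<notin> ?A" using fg(5,6) by (simp add: curve_def)
    then have "card ?S = 3" using S0 by simp
    moreover have "\<Sum>?S = (\<Sum>T, u1, u2, u3)"
      using * S0(4) eqs(3) by (simp add: add.commute)
    moreover have "inj_on fst ?S" using fg T' by (auto simp: curve_def)
    ultimately show ?thesis by (intro exI[of _ ?S]) simp
  qed
qed

lemma card_curves_axis:
  assumes "finite C" "0 \<notin> C" "m > 0"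
  shows "finite (curves m b C)" "finite (axis m :: ('a::zero \<times> _) set)"
    "card (curves m b C) = card C * 2 ^ m" "card (axis m :: ('a \<times> _) set) = 2 ^ m - 1"
proof -
  show "finite (curves m b C)" "finite (axis m :: ('a \<times> _) set)"
    using assms finite_gf by (auto simp: curves_def axis_def)
  have "inj_on (\<lambda>(h, x). curve b h x) (C \<times> gf m)"
    by (auto simp: inj_on_def curve_def)
  then show "card (curves m b C) = card C * 2 ^ m"
    using assms by (simp add: curves_def card_image card_cartesian_product card_gf)
  have "inj_on (\<lambda>w. (0::'a, 0::f2bar, 0::f2bar, w)) (gf m - {0})"
    by (auto simp: inj_on_def)
  then show "card (axis m :: ('a \<times> _) set) = 2 ^ m - 1"
    using assms finite_gf by (simp add: axis_def card_image card_gf)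
qed

lemma elem2_total:
  assumes "m > 0"
  shows "elem2 (bvec r \<times> gf m \<times> gf m \<times> gf m) (r + 3 * m)"
proof -
  have "r + 3 * m = r + (m + (m + m))" by simp
  then show ?thesis
    by (simp only:) (intro elem2_Times elem2_bvec elem2_gf assms)
qed

lemma curves_axis_subset:
  assumes "C \<subseteq> bvec r" "b ` C \<subseteq> gf m"
  shows "curves m b C \<subseteq> bvec r \<times> gf m \<times> gf m \<times> gf m" "axis m \<subseteq> bvec r \<times> gf m \<times> gf m \<times> gf m"
proof -
  have "b h \<in> gf m" if "h \<in> C" for h using that assms(2) by blast
  then show "curves m b C \<subseteq> bvec r \<times> gf m \<times> gf m \<times> gf m"
    using assms(1) by (auto simp: curves_def curve_def intro!: gf_mult gf_power)
  show "axis m \<subseteq> bvec r \<times> gf m \<times> gf m \<times> gf m"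
    by (auto simp: axis_def bvec_def)
qed

text \<open>Labels below \<open>2 ^ m\<close> are turned into field elements by an enumeration of
  \<open>gf m\<close>, so columns of distinct classes receive distinct points.\<close>

lemma cover23_curves:
  fixes c :: "(nat \<Rightarrow> bit) \<Rightarrow> nat"
  assumes C: "cover23 (bvec r) C c" and C0: "0 \<notin> C" and m: "m > 0"
    and lab: "c ` C \<subseteq> {..<2 ^ m}"
  shows "\<exists>b. cover23 (bvec r \<times> gf m \<times> gf m \<times> gf m) (curves m b C \<union> axis m) fst"
proof -
  have CV: "C \<subseteq> bvec r" "finite C" using C by (auto simp: cover23_def)
  obtain \<iota> :: "nat \<Rightarrow> f2bar" where \<iota>: "bij_betw \<iota> {..<2 ^ m} (gf m)"
    using ex_bij_betw_nat_finite[OF finite_gf[OF m]] m by (auto simp: lessThan_atLeast0 card_gf)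
  define b where "b h = \<iota> (c h)" for h
  have b: "b ` C \<subseteq> gf m" using lab \<iota> by (auto simp: b_def bij_betw_def)
  have "cover23 (bvec r \<times> gf m \<times> gf m \<times> gf m) (curves m b C \<union> axis m) fst"
    unfolding cover23_def
  proof (intro conjI ballI)
    show "curves m b C \<union> axis m \<subseteq> bvec r \<times> gf m \<times> gf m \<times> gf m"
      using curves_axis_subset[OF CV(1) b] by blast
    show "finite (curves m b C \<union> axis m)" using card_curves_axis[OF CV(2) C0 m] by blast
    fix v assume "v \<in> bvec r \<times> gf m \<times> gf m \<times> gf m"
    then obtain p u1 u2 u3 where v: "v = (p, u1, u2, u3)" "p \<in> bvec r"
      "u1 \<in> gf m" "u2 \<in> gf m" "u3 \<in> gf m" by auto
    obtain T where T: "T \<subseteq> C" "card T \<in> {2, 3}" "\<Sum>T = p" "inj_on c T"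
      using C v(2) by (rule cover23E)
    have "inj_on b T"
      using T(1,4) lab \<iota> by (auto simp: b_def inj_on_def bij_betw_def image_subset_iff subset_iff)
    from sum_curves[OF T(1,2) this C0 b v(3-5)]
    show "\<exists>S\<subseteq>curves m b C \<union> axis m. card S \<in> {2, 3} \<and> \<Sum>S = v \<and> inj_on fst S"
      using v T(3) by simp
  qed
  then show ?thesis by (intro exI[of _ b])
qed

text \<open>The curves have \<open>card C * 2 ^ m\<close> points and the axis
  \<open>2 ^ m - 1\<close>, which add up to \<open>n\<close>; an additive bijection then moves the
  covering set into \<open>bvec (r + 3 * m)\<close>.\<close>

lemma code_curves:
  fixes c :: "(nat \<Rightarrow> bit) \<Rightarrow> nat"
  assumes C: "cover23 (bvec r) C c" and C0: "0 \<notin> C" and m: "m > 0"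
    and lab: "c ` C \<subseteq> {..<2 ^ m}" and n: "n = (card C + 1) * 2 ^ m - 1"
    and small: "(n + 1)\<^sup>2 < 2 ^ (r + 3 * m)"
  shows "\<exists>H. is_code_Rl n (r + 3 * m) 3 3 2 H"
proof -
  have CV: "C \<subseteq> bvec r" "finite C" using C by (auto simp: cover23_def)
  let ?V = "bvec r \<times> gf m \<times> gf m \<times> gf m"
  obtain b where cov: "cover23 ?V (curves m b C \<union> axis m) fst"
    using cover23_curves[OF C C0 m lab] by blast
  have V: "elem2 ?V (r + 3 * m)" using m by (rule elem2_total)
  obtain \<phi> where \<phi>: "bij_betw \<phi> ?V (bvec (r + 3 * m))"
    "\<And>x y. x \<in> ?V \<Longrightarrow> y \<in> ?V \<Longrightarrow> \<phi> (x + y) = \<phi> x + \<phi> y"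
    using elem2_iso_bvec[OF V] by blast
  have sub: "curves m b C \<union> axis m \<subseteq> ?V" using cov by (simp add: cover23_def)
  have inj: "inj_on \<phi> ?V" using \<phi>(1) by (rule bij_betw_imp_inj_on)
  have z: "0 \<in> ?V" using V by (simp add: elem2_def)
  then have "\<phi> 0 = 0" using \<phi>(2)[OF z z] by simp
  have z': "0 \<notin> curves m b C \<union> axis m"
    using C0 by (auto simp: curves_def curve_def axis_def zero_prod_def)
  have "0 \<notin> \<phi> ` (curves m b C \<union> axis m)"
  proof
    assume "0 \<in> \<phi> ` (curves m b C \<union> axis m)"
    then obtain x where x: "x \<in> curves m b C \<union> axis m" "\<phi> x = \<phi> 0"
      using \<open>\<phi> 0 = 0\<close> by (metis imageE)
    then have "x = 0" using inj_onD[OF inj x(2) _ z] sub by blast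
    then show False using z' x(1) by blast
  qed
  moreover have "card (\<phi> ` (curves m b C \<union> axis m)) = n"
  proof -
    have disj: "curves m b C \<inter> axis m = {}"
      using C0 by (auto simp: curves_def curve_def axis_def)
    note card = card_curves_axis[OF CV(2) C0 m]
    have "card (curves m b C \<union> axis m) = card C * 2 ^ m + (2 ^ m - 1)"
      unfolding card_Un_disjoint[OF card(1,2) disj] card(3,4) ..
    moreover have "card (\<phi> ` (curves m b C \<union> axis m)) = card (curves m b C \<union> axis m)"
      by (rule card_image[OF inj_on_subset[OF inj sub]])
    ultimately show ?thesis using n by simp
  qed
  ultimately show ?thesis
    by (intro code_of_cover23[OF cover23_image[OF V cov \<phi>(1)]] small \<phi>(2))
qed

section \<open>Binary vectors as lists\<close>

definition bits :: "string \<Rightarrow> bool list" where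
  "bits = map (\<lambda>c. c = CHR ''1'')"

definition xorl :: "bool list \<Rightarrow> bool list \<Rightarrow> bool list" where
  "xorl x y = map2 (\<noteq>) x y"

lemma length_xorl [simp]: "length (xorl x y) = min (length x) (length y)"
  by (simp add: xorl_def)

text \<open>Spelled out without conditionals, since those make evaluation by rewriting quadratic.\<close>

fun tails :: "bool \<Rightarrow> bool list list \<Rightarrow> bool list list" where
  "tails b [] = []"
| "tails b ([] # L) = tails b L"
| "tails True ((True # xs) # L) = xs # tails True L"
| "tails True ((False # xs) # L) = tails True L"
| "tails False ((True # xs) # L) = tails False L"
| "tails False ((False # xs) # L) = xs # tails False L"

text \<open>A search by first bit, which avoids a separate membership test for each of the
  \<open>2 ^ n\<close> vectors. At depth zero the only possible entry is the empty list.\<close>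

fun covers :: "nat \<Rightarrow> bool list list \<Rightarrow> bool" where
  "covers 0 L \<longleftrightarrow> L \<noteq> []"
| "covers (Suc n) L \<longleftrightarrow> covers n (tails True L) \<and> covers n (tails False L)"

lemma set_tails: "set (tails b L) = {xs. b # xs \<in> set L}"
  by (induction b L rule: tails.induct) auto

lemma covers_mem:
  assumes "covers n L" "\<And>l. l \<in> set L \<Longrightarrow> length l = n" "length v = n"
  shows "v \<in> set L"
  using assms
proof (induction n arbitrary: L v)
  case 0
  then show ?case by (cases L) auto
next
  case (Suc n)
  obtain b w where v: "v = b # w" "length w = n"
    using Suc.prems(3) by (cases v) auto
  have "covers n (tails b L)" using Suc.prems(1) by (cases b) auto
  moreover have "length l = n" if "l \<in> set (tails b L)" for l
    using that Suc.prems(2)[of "b # l"] by (simp add: set_tails)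
  ultimately have "w \<in> set (tails b L)" using v Suc.IH by blast
  then show ?case using v by (simp add: set_tails)
qed

fun ksums :: "nat \<Rightarrow> nat \<Rightarrow> bool list list \<Rightarrow> bool list list" where
  "ksums n 0 L = [replicate n False]"
| "ksums n (Suc k) [] = []"
| "ksums n (Suc k) (x # L) = map (xorl x) (ksums n k L) @ ksums n (Suc k) L"

text \<open>Additivity is restricted to one length because \<open>xorl\<close> truncates to the
  shorter argument.\<close>

definition list_hom :: "nat \<Rightarrow> (bool list \<Rightarrow> 'a::ab_group_add) \<Rightarrow> bool" where
  "list_hom n f \<longleftrightarrow> f (replicate n False) = 0 \<and>
     (\<forall>x y. length x = n \<longrightarrow> length y = n \<longrightarrow> f (xorl x y) = f x + f y)"

text \<open>\<open>ksums\<close> selects positions; distinctness of \<open>L\<close> turns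
  \<open>k\<close> positions into a set of \<open>k\<close> elements.\<close>

lemma ksums_mem:
  assumes "v \<in> set (ksums n k L)" "distinct L" "\<And>x. x \<in> set L \<Longrightarrow> length x = n" "list_hom n f"
  shows "length v = n \<and> (\<exists>T\<subseteq>set L. card T = k \<and> f v = sum f T)"
  using assms
proof (induction n k L arbitrary: v rule: ksums.induct)
  case (1 n L)
  then show ?case by (auto simp: list_hom_def intro!: exI[of _ "{}"])
next
  case (2 n k)
  then show ?case by simp
next
  case (3 n k x L)
  consider w where "w \<in> set (ksums n k L)" "v = xorl x w" | "v \<in> set (ksums n (Suc k) L)"
    using 3(3) by auto
  then show ?case
  proof cases
    case 1
    have "length w = n \<and> (\<exists>T\<subseteq>set L. card T = k \<and> f w = sum f T)"
      using 3(1)[OF 1(1)] 3(4,5,6) by simp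
    then obtain T where T: "length w = n" "T \<subseteq> set L" "card T = k" "f w = sum f T"
      by blast
    have "x \<notin> T" using T(2) 3(4) by auto
    moreover have "finite T" using T(2) finite_subset by blast
    ultimately have "card (insert x T) = Suc k" "sum f (insert x T) = f x + f w"
      using T by auto
    moreover have "f v = f x + f w" "length v = n"
      using 3(6) T(1) 1(2) 3(5)[of x] by (auto simp: list_hom_def)
    ultimately show ?thesis
      using T(2) by (intro conjI exI[of _ "insert x T"]) auto
  next
    case 2
    have "length v = n \<and> (\<exists>T\<subseteq>set L. card T = Suc k \<and> f v = sum f T)"
      using 3(2)[OF 2] 3(4,5,6) by simp
    then show ?thesis by auto
  qed
qed

section \<open>The binary Golay code\<close>

definition vec :: "bool list \<Rightarrow> nat \<Rightarrow> bit" where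
  "vec l i = of_bool (i < length l \<and> l ! i)"

lemma vec_bvec: "vec l \<in> bvec (length l)"
  by (simp add: vec_def bvec_def)

lemma list_hom_vec: "list_hom n vec"
  by (auto simp: list_hom_def vec_def xorl_def fun_eq_iff)

lemma inj_vec: "inj_on vec {l. length l = n}"
proof (rule inj_onI)
  fix x y assume *: "x \<in> {l. length l = n}" "y \<in> {l. length l = n}" "vec x = vec y"
  have "x ! i = y ! i" if "i < n" for i
    using fun_cong[OF *(3), of i] *(1,2) that by (simp add: vec_def of_bool_def split: if_splits)
  then show "x = y"
    using * by (intro nth_equalityI) auto
qed

lemma bvec_vec:
  assumes "v \<in> bvec n"
  obtains l where "length l = n" "v = vec l"
proof
  show "length (map (\<lambda>i. v i = 1) [0..<n]) = n" by simp
  show "v = vec (map (\<lambda>i. v i = 1) [0..<n])"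
  proof
    fix i show "v i = vec (map (\<lambda>i. v i = 1) [0..<n]) i"
      using assms by (cases "i < n"; cases "v i") (simp_all add: vec_def bvec_def)
  qed
qed

text \<open>The column number \<open>j\<close> is \<open>x\<^sup>j\<close> modulo the generator polynomial
  \<open>x\<^sup>1\<^sup>1 + x\<^sup>9 + x\<^sup>7 + x\<^sup>6 + x\<^sup>5 + x + 1\<close>, constant coefficient first.\<close>

definition golay :: "bool list list" where
  "golay = map bits
    [''10000000000'', ''01000000000'', ''00100000000'', ''00010000000'', ''00001000000'', ''00000100000'',
     ''00000010000'', ''00000001000'', ''00000000100'', ''00000000010'', ''00000000001'', ''11000111010'',
     ''01100011101'', ''11110110100'', ''01111011010'', ''00111101101'', ''11011001100'', ''01101100110'',
     ''00110110011'', ''11011100011'', ''10101001011'', ''10010011111'', ''10001110101'']"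

text \<open>The prepended zero list also records that no column is zero.\<close>

lemma golay_distinct: "distinct (replicate 11 False # golay)"
  by code_simp

lemma golay_length: "length golay = 23" "list_all (\<lambda>x. length x = 11) golay"
  by code_simp+

text \<open>The code is perfect: 1 + 23 + 253 + 1771 = 2048 = 2^11, so the lists just suffice, each
  vector occurring once.\<close>

lemma golay_covers:
  "covers 11 (ksums 11 0 golay @ ksums 11 1 golay @ ksums 11 2 golay @ ksums 11 3 golay)"
  by code_simp

text \<open>Zero and the single columns are set apart because in a perfect code they are not sums of
  two or three columns; the set of codimension 26 must treat them separately.\<close>

lemma golay_code:
  obtains C where "C \<subseteq> bvec 11" "card C = 23" "0 \<notin> C"
    "\<And>v. v \<in> bvec 11 \<Longrightarrow> v = 0 \<or> v \<in> C \<or> (\<exists>T\<subseteq>C. card T \<in> {2, 3} \<and> \<Sum>T = v)"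
proof
  have len: "length x = 11" if "x \<in> set golay" for x
    using that golay_length by (simp add: list_all_iff)
  have dist: "distinct golay" using golay_distinct by simp
  have inj: "inj_on vec (set golay)"
    using inj_vec[of 11] by (rule inj_on_subset) (use len in auto)
  have v0: "vec (replicate 11 False) = 0"
    using list_hom_vec[of 11] by (simp add: list_hom_def)
  show "vec ` set golay \<subseteq> bvec 11"
    using vec_bvec len by (metis image_subsetI)
  show "card (vec ` set golay) = 23"
    using inj dist by (simp add: card_image distinct_card golay_length)
  show "0 \<notin> vec ` set golay"
  proof
    assume "0 \<in> vec ` set golay"
    then obtain x where x: "x \<in> set golay" "vec x = vec (replicate 11 False)"
      using v0 by (metis imageE)
    then have "x = replicate 11 False"
      using inj_onD[OF inj_vec[of 11] x(2)] len by simp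
    then show False using x golay_distinct by simp
  qed
  fix v assume "v \<in> bvec 11"
  then obtain l where l: "length l = 11" "v = vec l" by (rule bvec_vec)
  let ?L = "ksums 11 0 golay @ ksums 11 1 golay @ ksums 11 2 golay @ ksums 11 3 golay"
  note sm = ksums_mem[OF _ dist len list_hom_vec]
  have "l \<in> set ?L"
    by (rule covers_mem[OF golay_covers _ l(1)]) (use sm in auto)
  then obtain k where k: "k \<in> {0, 1, 2, 3}" "l \<in> set (ksums 11 k golay)"
    unfolding set_append by blast
  obtain T where T: "T \<subseteq> set golay" "card T = k" "v = sum vec T"
    using sm[OF k(2)] l by blast
  have injT: "inj_on vec T" using inj T(1) by (rule inj_on_subset)
  have T': "vec ` T \<subseteq> vec ` set golay" "card (vec ` T) = k" "\<Sum>(vec ` T) = v"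
    using T injT by (auto simp: card_image sum.reindex)
  consider "k = 0" | "k = 1" | "k \<in> {2, 3}" using k(1) by blast
  then show "v = 0 \<or> v \<in> vec ` set golay \<or> (\<exists>T\<subseteq>vec ` set golay. card T \<in> {2, 3} \<and> \<Sum>T = v)"
  proof cases
    case 1
    have "finite T" using T(1) finite_subset by blast
    then show ?thesis using 1 T by simp
  next
    case 2
    then obtain x where "vec ` T = {x}" using T'(2) by (metis card_1_singletonE)
    then show ?thesis using T' by auto
  next
    case 3
    then show ?thesis using T' by blast
  qed
qed

section \<open>A saturating set over the field with 32 elements\<close>

fun cross :: "bool list list list \<Rightarrow> bool list list" where
  "cross [] = []"
| "cross (g # gs) = concat (map (\<lambda>x. map (xorl x) (concat gs)) g) @ cross gs"

lemma cross_mem: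
  assumes "v \<in> set (cross gs)"
  shows "\<exists>i j x y. i < j \<and> j < length gs \<and> x \<in> set (gs ! i) \<and> y \<in> set (gs ! j) \<and> v = xorl x y"
  using assms
proof (induction gs)
  case (Cons g gs)
  consider "v \<in> set (cross gs)"
    | x y h where "x \<in> set g" "y \<in> set h" "h \<in> set gs" "v = xorl x y"
    using Cons.prems by auto
  then show ?case
  proof cases
    case 1
    then obtain i j x y where "i < j" "j < length gs" "x \<in> set (gs ! i)" "y \<in> set (gs ! j)" "v = xorl x y"
      using Cons.IH by blast
    then show ?thesis
      by (intro exI[of _ "Suc i"] exI[of _ "Suc j"] exI[of _ x] exI[of _ y]) simp
  next
    case 2
    then obtain j where "j < length gs" "gs ! j = h" by (metis in_set_conv_nth)
    with 2 show ?thesis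
      by (intro exI[of _ 0] exI[of _ "Suc j"] exI[of _ x] exI[of _ y]) simp
  qed
qed simp

lemma distinct_concat_nth:
  assumes "distinct (concat gs)" "i < j" "j < length gs"
  shows "set (gs ! i) \<inter> set (gs ! j) = {}"
  using assms
proof (induction gs arbitrary: i j)
  case (Cons g gs)
  show ?case
  proof (cases i)
    case 0
    then obtain j' where "j = Suc j'" "j' < length gs" using Cons.prems by (cases j) auto
    moreover from this have "set (gs ! j') \<subseteq> set (concat gs)" using nth_mem by fastforce
    ultimately show ?thesis using 0 Cons.prems(1) by auto
  next
    case (Suc i')
    then obtain j' where "j = Suc j'" using Cons.prems(2) by (cases j) auto
    then show ?thesis using Suc Cons.prems Cons.IH[of i' j'] by simp
  qed
qed simp

text \<open>Multiplication by a root \<open>a\<close> of \<open>x\<^sup>5 + x\<^sup>2 + 1\<close> in the basis \<open>1, a, a\<^sup>2, a\<^sup>3, a\<^sup>4\<close>.\<close>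

fun shift :: "bool list \<Rightarrow> bool list" where
  "shift [a, b, c, d, e] = [e, a, b \<noteq> e, c, d]"
| "shift l = l"

fun powl :: "nat \<Rightarrow> bool list" where
  "powl 0 = [True, False, False, False, False]"
| "powl (Suc n) = shift (powl n)"

text \<open>Found by simulated annealing among the subsets of \<open>F\<^sub>2\<^sup>1\<^sup>0\<close> invariant under a linear map of
  order 3, then moved by a linear map that makes the slopes \<open>1, a, \<dots>, a\<^sup>2\<^sup>2\<close> occur (\<open>slopes\<close> lists where).
  A string stands for a pair of field elements: each half gives the coordinates of one of them with
  respect to \<open>1, a, a\<^sup>2, a\<^sup>3, a\<^sup>4\<close>. The rows are the classes.\<close>

definition blocks :: "bool list list list" where
  "blocks = map (map bits)
    [[''0100100000'', ''0111101110'', ''0001101011'', ''0011111111''],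
     [''0000110000'', ''0100100110'', ''1100110001'', ''0001101101'', ''0101010111''],
     [''1100000010'', ''1100101110'', ''1111001011'', ''0101001111''],
     [''1000110001'', ''0000001101'', ''1011010011'', ''0100110111''],
     [''0111000100'', ''1101101100'', ''1111101001'', ''0111010101'', ''1100001011'', ''0011101111''],
     [''1011100010'', ''1001010110'', ''0100101101'', ''1010010011'', ''1010011111'', ''1111011111''],
     [''0110110100'', ''0101111010'', ''0000110001'', ''0010100101''],
     [''1101101000'', ''0001000010'', ''1111010111'', ''1101101111''],
     [''0110101010'', ''0110000110'', ''0101100011'', ''1111100111''],
     [''0000010000'', ''0101011100'', ''1110101110'', ''0001100001''],
     [''1111010000'', ''0011111010'', ''0001000110'', ''0001000101'', ''0011111101'', ''1000100111'']]"

text \<open>Entry number \<open>j\<close> is an exponent \<open>k\<close> for which the point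
  \<open>(a ^ k, a ^ (j + k))\<close>, of slope \<open>a ^ j\<close>, belongs to
  \<open>blocks\<close>.\<close>

definition slopes :: "nat list" where
  "slopes = [3, 19, 13, 10, 3, 6, 4, 21, 6, 28, 5, 13, 9, 13, 13, 15, 16, 3, 6, 21, 5, 12, 18]"

lemma blocks_distinct: "distinct (replicate 10 False # concat blocks)"
  by code_simp

lemma blocks_length:
  "length blocks = 11" "length (concat blocks) = 51" "list_all (\<lambda>x. length x = 10) (concat blocks)"
  "length slopes = 23"
  by code_simp+

text \<open>There are 1275 - 97 = 1178 pairs from different classes for 1023 nonzero vectors. Zero
  is no sum of two distinct points and is added by hand.\<close>

lemma blocks_covers: "covers 10 (replicate 10 False # cross blocks)"
  by code_simp

lemma blocks_slopes:
  "list_all (\<lambda>(j, k). powl k @ powl (j + k) \<in> set (concat blocks)) (zip [0..<23] slopes)"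
  by code_simp

lemma powl_31: "powl 31 = powl 0"
  by code_simp

section \<open>Coordinates in the field with 32 elements\<close>

fun ev :: "f2bar \<Rightarrow> bool list \<Rightarrow> f2bar" where
  "ev a [] = 0"
| "ev a (b # l) = of_bool b + a * ev a l"

lemma ev_xorl: "length x = length y \<Longrightarrow> ev a (xorl x y) = ev a x + ev a y"
  by (induction x y rule: list_induct2) (auto simp: xorl_def algebra_simps)

lemma take_xorl: "take n (xorl x y) = xorl (take n x) (take n y)"
  and drop_xorl: "drop n (xorl x y) = xorl (drop n x) (drop n y)"
  by (simp_all add: xorl_def take_map drop_map take_zip drop_zip)

lemma ev_replicate: "ev a (replicate n False) = 0"
  by (induction n) auto

lemma ev_gf: "a \<in> gf m \<Longrightarrow> ev a l \<in> gf m"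
  by (induction l) (auto simp del: of_bool_eq_1_iff)

lemma list_length_5: "length l = 5 \<Longrightarrow> \<exists>a b c d e. l = [a, b, c, d, e]"
  by (auto simp: numeral_eq_Suc length_Suc_conv)

lemma length_powl [simp]: "length (powl n) = 5"
proof (induction n)
  case (Suc n)
  then obtain a b c d e where "powl n = [a, b, c, d, e]"
    using list_length_5 by blast
  then show ?case by simp
qed simp

lemma ev_powl:
  assumes "a ^ 5 = a\<^sup>2 + 1"
  shows "ev a (powl n) = a ^ n"
proof (induction n)
  case (Suc n)
  obtain b c d e f where p: "powl n = [b, c, d, e, f]"
    using list_length_5[OF length_powl] by blast
  have "a * ev a [b, c, d, e, f] = a * of_bool b + a\<^sup>2 * of_bool c + a ^ 3 * of_bool d + a ^ 4 * of_bool e + a ^ 5 * of_bool f"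
    by (simp add: algebra_simps power_numeral_reduce)
  also have "\<dots> = ev a (shift [b, c, d, e, f])"
    \<comment> \<open>The overflow \<open>a ^ 5\<close> becomes \<open>a\<^sup>2 + 1\<close>; only
      \<open>c\<close> and \<open>f\<close> meet in one coefficient, that of
      \<open>a\<^sup>2\<close>.\<close>
    unfolding assms by (cases c; cases f) (simp_all add: algebra_simps power_numeral_reduce)
  finally show ?case using Suc p by simp
qed simp

text \<open>Any root of \<open>x^5 + x^2 + 1\<close> will do: \<open>powl_31\<close> gives
  \<open>a ^ 31 = 1\<close>, and as 31 is prime and \<open>a \<noteq> 1\<close>, the order is
  exactly 31.\<close>

lemma primitive_root:
  obtains a :: f2bar where "a ^ 5 = a\<^sup>2 + 1" "a \<in> gf 5" "a \<noteq> 0" "inj_on (\<lambda>n. a ^ n) {..<31}"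
proof -
  obtain a :: f2bar where "poly [:1, 0, 1, 0, 0, 1:] a = 0"
    using alg_closed_imp_poly_has_root[of "[:1, 0, 1, 0, 0, 1::f2bar:]"] by auto
  then have "a ^ 5 + (a\<^sup>2 + 1) = 0"
    by (simp add: algebra_simps power_numeral_reduce del: add_eq_0_f2bar)
  then have a: "a ^ 5 = a\<^sup>2 + 1" by simp
  then have a0: "a \<noteq> 0" by auto
  have a1: "a \<noteq> 1" using a by auto
  have a31: "a ^ 31 = 1"
    using ev_powl[OF a, of 31] unfolding powl_31 by simp
  then have "a ^ 2 ^ 5 = a"
    using power_Suc[of a 31] by simp
  then have "a \<in> gf 5" by (simp add: gf_def)
  moreover have no: "a ^ e \<noteq> 1" if e31: "e \<in> {1..<31}" for e
  proof
    assume e: "a ^ e = 1"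
    have "\<not> 31 dvd e" using e31 by (auto dest: dvd_imp_le)
    then have "coprime 31 e" by (intro prime_imp_coprime) simp_all
    then have "gcd e 31 = 1" by (metis coprime_commute coprime_imp_gcd_eq_1)
    then obtain x y where "e * x = 31 * y + 1"
      using bezout_nat[of e 31] e31 by auto
    then have "(a ^ e) ^ x = (a ^ 31) ^ y * a"
      by (simp flip: power_mult)
    then show False using a1 a31 e by simp
  qed
  have "a ^ i \<noteq> a ^ j" if "i < j" "j < 31" for i j
  proof
    assume "a ^ i = a ^ j"
    also have "a ^ j = a ^ i * a ^ (j - i)" using that by (simp flip: power_add)
    finally have "a ^ (j - i) = 1" using a0 by simp
    moreover have "1 \<le> j - i" "j - i < 31" using that by arith+
    ultimately show False using no by simp
  qed
  then have "inj_on (\<lambda>n. a ^ n) {..<31}"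
    by (metis (mono_tags, lifting) inj_onI lessThan_iff linorder_neqE_nat)
  ultimately show ?thesis using that a a0 by blast
qed

text \<open>The 31 distinct powers of \<open>a\<close> exhaust the nonzero elements and all have
  coordinate lists, so \<open>ev a\<close> is onto; injectivity follows by counting 32
  lists.\<close>

lemma ev_bij:
  assumes a: "a ^ 5 = a\<^sup>2 + 1" "a \<in> gf 5" "a \<noteq> 0" "inj_on (\<lambda>n. a ^ n) {..<31}"
  shows "bij_betw (ev a) {l. length l = 5} (gf 5)"
proof -
  have card: "card {l :: bool list. length l = 5} = 32"
    using card_lists_length_eq[of "UNIV :: bool set" 5] by simp
  have powers: "(\<lambda>n. a ^ n) ` {..<31} = gf 5 - {0}"
  proof (rule card_subset_eq)
    show "finite (gf 5 - {0})" by (simp add: finite_gf)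
    show "(\<lambda>n. a ^ n) ` {..<31} \<subseteq> gf 5 - {0}" using a(2,3) by auto
    show "card ((\<lambda>n. a ^ n) ` {..<31}) = card (gf 5 - {0})"
      using a(4) by (simp add: card_image card_gf finite_gf)
  qed
  have "x \<in> ev a ` {l. length l = 5}" if "x \<in> gf 5" for x
  proof (cases "x = 0")
    case True
    then have "x = ev a (replicate 5 False)" by (simp only: ev_replicate)
    then show ?thesis by simp
  next
    case False
    then have "x \<in> (\<lambda>n. a ^ n) ` {..<31}" using that powers by simp
    then obtain n where "x = ev a (powl n)" using ev_powl[OF a(1)] by auto
    then show ?thesis by simp
  qed
  moreover have "ev a ` {l. length l = 5} \<subseteq> gf 5" using ev_gf[OF a(2)] by blast
  ultimately have "ev a ` {l. length l = 5} = gf 5" by blast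
  moreover from this have "inj_on (ev a) {l. length l = 5}"
    using card by (intro eq_card_imp_inj_on card_ge_0_finite) (simp_all add: card_gf)
  ultimately show ?thesis by (simp add: bij_betw_def)
qed

text \<open>The facts evaluated on bit lists are carried to pairs of field elements by
  \<open>f\<close>, which evaluates the two halves of a list of length 10.\<close>

lemma saturating_set:
  obtains a :: f2bar and D and cl :: "f2bar \<times> f2bar \<Rightarrow> nat" where
    "a \<in> gf 5" "a \<noteq> 0" "inj_on (\<lambda>n. a ^ n) {..<31}"
    "D \<subseteq> gf 5 \<times> gf 5" "card D = 51" "0 \<notin> D" "cl ` D \<subseteq> {..<11}"
    "\<And>y. y \<in> gf 5 \<times> gf 5 \<Longrightarrow> y \<noteq> 0 \<Longrightarrow> \<exists>d\<in>D. \<exists>e\<in>D. cl d \<noteq> cl e \<and> y = d + e"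
    "\<And>j. j < 23 \<Longrightarrow> \<exists>x\<in>gf 5 - {0}. (x, a ^ j * x) \<in> D"
proof -
  obtain a :: f2bar where a: "a ^ 5 = a\<^sup>2 + 1" "a \<in> gf 5" "a \<noteq> 0" "inj_on (\<lambda>n. a ^ n) {..<31}"
    by (rule primitive_root)
  have bij: "inj_on (ev a) {l. length l = 5}" "ev a ` {l. length l = 5} = gf 5"
    using ev_bij[OF a] by (simp_all add: bij_betw_def)
  define f where "f l = (ev a (take 5 l), ev a (drop 5 l))" for l
  have f_add: "f (xorl x y) = f x + f y" if "length x = 10" "length y = 10" for x y
    using that by (simp add: f_def take_xorl drop_xorl ev_xorl)
  have f_0: "f (replicate 10 False) = 0"
    by (simp add: f_def ev_replicate zero_prod_def)
  have f_inj: "x = y" if "length x = 10" "length y = 10" "f x = f y" for x y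
  proof -
    have "take 5 x = take 5 y" "drop 5 x = drop 5 y"
      using that by (auto simp: f_def intro!: inj_onD[OF bij(1)])
    then show ?thesis by (metis append_take_drop_id)
  qed
  have len: "length x = 10" if "x \<in> set (concat blocks)" for x
    using that blocks_length(3) by (simp only: list_all_iff)
  let ?L = "set (concat blocks)"
  have f_injL: "inj_on f ?L" using f_inj len by (metis inj_onI)
  have dist: "distinct (concat blocks)" "replicate 10 False \<notin> ?L"
    using blocks_distinct by simp_all
  \<comment> \<open>The row number; it is unique because \<open>f\<close> is injective on the points
    and the rows are disjoint.\<close>
  define cl where "cl d = (SOME i. i < length blocks \<and> (\<exists>x\<in>set (blocks ! i). f x = d))" for d
  have memL: "x \<in> ?L" if "x \<in> set (blocks ! i)" "i < length blocks" for x i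
    using that by auto
  have cl: "cl (f x) = i" if x: "x \<in> set (blocks ! i)" "i < length blocks" for x i
    unfolding cl_def
  proof (rule some_equality)
    show "i < length blocks \<and> (\<exists>y\<in>set (blocks ! i). f y = f x)" using that by blast
    fix j assume j: "j < length blocks \<and> (\<exists>y\<in>set (blocks ! j). f y = f x)"
    then obtain y where "y \<in> set (blocks ! j)" "f y = f x" by blast
    then have "x \<in> set (blocks ! j)" using inj_onD[OF f_injL] memL x j by metis
    then show "j = i"
      using distinct_concat_nth[OF dist(1), of i j] distinct_concat_nth[OF dist(1), of j i] x j
      by (metis disjoint_iff linorder_neqE_nat)
  qed
  show ?thesis
  proof (rule that[of a "f ` ?L" cl])
    show "a \<in> gf 5" "a \<noteq> 0" "inj_on (\<lambda>n. a ^ n) {..<31}" by fact+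
    show "f ` ?L \<subseteq> gf 5 \<times> gf 5" using ev_gf[OF a(2)] by (auto simp: f_def)
    show "card (f ` ?L) = 51"
      unfolding card_image[OF f_injL] distinct_card[OF dist(1)] by (rule blocks_length)
    show "0 \<notin> f ` ?L"
    proof
      assume "0 \<in> f ` ?L"
      then obtain x where "x \<in> ?L" "f x = f (replicate 10 False)" unfolding f_0 by (metis imageE)
      then show False using f_inj len dist(2) by (metis length_replicate)
    qed
    have "cl (f x) < 11" if x: "x \<in> ?L" for x
    proof -
      obtain i where "i < length blocks" "x \<in> set (blocks ! i)"
        using x by (metis UN_E in_set_conv_nth set_concat)
      then show ?thesis using cl blocks_length(1) by simp
    qed
    then show "cl ` f ` ?L \<subseteq> {..<11}" by blast
    fix y assume y: "y \<in> gf 5 \<times> gf 5" "y \<noteq> 0"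
    then obtain u v where uv: "length u = 5" "length v = 5" "y = (ev a u, ev a v)"
      using bij(2) by blast
    then have fy: "y = f (u @ v)" by (simp add: f_def)
    have "u @ v \<in> set (replicate 10 False # cross blocks)"
    proof (rule covers_mem[OF blocks_covers])
      fix l assume "l \<in> set (replicate 10 False # cross blocks)"
      then show "length l = 10"
        using cross_mem[of l blocks] memL len by fastforce
    qed (simp add: uv)
    moreover have "u @ v \<noteq> replicate 10 False" using y(2) fy f_0 by auto
    ultimately obtain i j x z where *: "i < j" "j < length blocks"
      "x \<in> set (blocks ! i)" "z \<in> set (blocks ! j)" "u @ v = xorl x z"
      using cross_mem by (metis set_ConsD)
    then have "x \<in> ?L" "z \<in> ?L" using memL by simp_all
    moreover have "cl (f x) \<noteq> cl (f z)" using * cl by simp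
    moreover have "y = f x + f z" using fy * f_add len calculation by simp
    ultimately show "\<exists>d\<in>f ` ?L. \<exists>e\<in>f ` ?L. cl d \<noteq> cl e \<and> y = d + e" by blast
  next
    fix j :: nat assume j: "j < 23"
    have "(j, slopes ! j) \<in> set (zip [0..<23] slopes)"
      using j blocks_length(4) by (auto simp: in_set_zip intro!: exI[of _ j])
    then have "powl (slopes ! j) @ powl (j + slopes ! j) \<in> ?L"
      using blocks_slopes by (auto simp: list_all_iff)
    then have "f (powl (slopes ! j) @ powl (j + slopes ! j)) \<in> f ` ?L" by blast
    then have "(a ^ (slopes ! j), a ^ j * a ^ (slopes ! j)) \<in> f ` ?L"
      by (simp add: f_def ev_powl[OF a(1)] power_add)
    then show "\<exists>x\<in>gf 5 - {0}. (x, a ^ j * x) \<in> f ` ?L"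
      using a(2,3) by (intro bexI[of _ "a ^ (slopes ! j)"]) auto
  qed
qed

section \<open>The code of codimension 26\<close>

lemma inj_on_two: "lab x \<noteq> lab y \<Longrightarrow> inj_on lab {x, y} \<and> card {x, y} \<in> {2, 3} \<and> \<Sum>{x, y} = x + (y :: 'a::ab_group_add)"
  by (cases "x = y") auto

lemma inj_on_three:
  "lab x \<noteq> lab y \<Longrightarrow> lab x \<noteq> lab z \<Longrightarrow> lab y \<noteq> lab z \<Longrightarrow>
    inj_on lab {x, y, z} \<and> card {x, y, z} \<in> {2, 3} \<and> \<Sum>{x, y, z} = x + y + (z :: 'a::ab_group_add)"
  by (subgoal_tac "x \<noteq> y \<and> x \<noteq> z \<and> y \<noteq> z") (auto simp: add.assoc)

text \<open>The first component \<open>p\<close> decides. If it is a sum of two or three Golay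
  columns, \<open>sum_curves\<close> applies. If it is a column, one curve point over
  \<open>p\<close> leaves a remainder for \<open>D\<close>. If it is zero, \<open>D\<close> and the
  axis suffice.\<close>

lemma start_cover:
  obtains B :: "((nat \<Rightarrow> bit) \<times> f2bar \<times> f2bar \<times> f2bar) set" and lab :: "(nat \<Rightarrow> bit) \<times> f2bar \<times> f2bar \<times> f2bar \<Rightarrow> nat"
  where "cover23 (bvec 11 \<times> gf 5 \<times> gf 5 \<times> gf 5) B lab" "card B = 818" "0 \<notin> B" "lab ` B \<subseteq> {..<37}"
proof -
  obtain G where G: "G \<subseteq> bvec 11" "card G = 23" "0 \<notin> G"
    and golay: "\<And>v. v \<in> bvec 11 \<Longrightarrow> v = 0 \<or> v \<in> G \<or> (\<exists>T\<subseteq>G. card T \<in> {2, 3} \<and> \<Sum>T = v)"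
    by (rule golay_code) (rule that)
  have finG: "finite G" using G(2) by (intro card_ge_0_finite) simp
  obtain idx where idx: "bij_betw idx G {0..<23::nat}"
    using ex_bij_betw_finite_nat[OF finG] G(2) by auto
  obtain a :: f2bar and D and cl :: "f2bar \<times> f2bar \<Rightarrow> nat" where a: "a \<in> gf 5" "a \<noteq> 0" "inj_on (\<lambda>n. a ^ n) {..<31}"
    and D: "D \<subseteq> gf 5 \<times> gf 5" "card D = 51" "0 \<notin> D" "cl ` D \<subseteq> {..<11::nat}"
    and two: "\<And>y. y \<in> gf 5 \<times> gf 5 \<Longrightarrow> y \<noteq> 0 \<Longrightarrow> \<exists>d\<in>D. \<exists>e\<in>D. cl d \<noteq> cl e \<and> y = d + e"
    and slope: "\<And>j. j < 23 \<Longrightarrow> \<exists>x\<in>gf 5 - {0}. (x, a ^ j * x) \<in> D"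
    by (rule saturating_set) (rule that)
  have a1: "a \<noteq> 1" using inj_onD[OF a(3), of 0 1] by auto
  \<comment> \<open>The points are exactly the slopes \<open>a ^ j\<close> with
    \<open>j < 23\<close> that \<open>D\<close> is known to meet.\<close>
  define b where "b g = a ^ idx g" for g
  have idx_less: "idx g < 23" if "g \<in> G" for g
    using idx that by (auto simp: bij_betw_def)
  have idx_inj: "g = h" if "idx g = idx h" "g \<in> G" "h \<in> G" for g h
    using idx that by (auto simp: bij_betw_def inj_on_def)
  have b_gf: "b g \<in> gf 5" "b g \<noteq> 0" for g
    using a by (auto simp: b_def)
  have b_inj: "inj_on b G"
  proof (rule inj_onI)
    fix g h assume gh: "g \<in> G" "h \<in> G" "b g = b h"
    then have "idx g = idx h"
      using inj_onD[OF a(3), of "idx g" "idx h"] idx_less[of g] idx_less[of h] by (simp add: b_def)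
    then show "g = h" using gh idx_inj by blast
  qed
  define plane where "plane d = (0 :: nat \<Rightarrow> bit, fst d, snd d, 0 :: f2bar)" for d :: "f2bar \<times> f2bar"
  define B where "B = curves 5 b G \<union> axis 5 \<union> plane ` D"
  \<comment> \<open>Labels below 23 belong to the curves, 23 to 33 to the classes of
    \<open>D\<close>, and 34 to 36 to the axis.\<close>
  define lab where "lab = (\<lambda>(g, x, y, z). if g \<noteq> 0 then idx g else if (x, y) \<noteq> 0 then 23 + cl (x, y)
      else if z = 1 then 34 else if z = a then 35 else (36::nat))"
  have lab_curve: "lab (curve b g x) = idx g" if "g \<in> G" for g x
    using that G(3) by (auto simp: lab_def curve_def)
  have lab_plane: "lab (plane d) = 23 + cl d" "23 + cl d < 34" if "d \<in> D" for d
    using that D(3,4) by (cases d, auto simp: lab_def plane_def zero_prod_def)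
  have lab_axis: "lab (0, 0, 0, w) = (if w = 1 then 34 else if w = a then 35 else 36)" for w
    by (auto simp: lab_def zero_prod_def)
  have lab_axis_ge: "lab (0, 0, 0, w) \<ge> 34" for w
    by (simp add: lab_axis)
  have B_curve: "curve b g x \<in> B" if "g \<in> G" "x \<in> gf 5" for g x
    using that by (auto simp: B_def curves_def)
  have B_axis: "(0, 0, 0, w) \<in> B" if "w \<in> gf 5" "w \<noteq> 0" for w
    using that by (auto simp: B_def axis_def)
  have B_plane: "plane d \<in> B" if "d \<in> D" for d
    using that by (auto simp: B_def)
  have B_cases: "(\<exists>g\<in>G. \<exists>x\<in>gf 5. s = curve b g x) \<or> (\<exists>w\<in>gf 5 - {0}. s = (0, 0, 0, w)) \<or> (\<exists>d\<in>D. s = plane d)"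
    if "s \<in> B" for s
    using that by (auto simp: B_def curves_def axis_def)
  have plane_add: "plane (d + e) = plane d + plane e" for d e
    by (simp add: plane_def)
  show ?thesis
  proof (rule that[of B lab])
    show "0 \<notin> B"
      using G(3) D(3) by (auto simp: B_def curves_def curve_def axis_def plane_def zero_prod_def)
    show "lab ` B \<subseteq> {..<37}"
    proof
      fix i assume "i \<in> lab ` B"
      then obtain s where s: "s \<in> B" "i = lab s" by blast
      then consider g x where "g \<in> G" "i = lab (curve b g x)" | w where "i = lab (0, 0, 0, w)"
        | d where "d \<in> D" "i = lab (plane d)"
        using B_cases by metis
      then show "i \<in> {..<37}"
      proof cases
        case 1
        then show ?thesis using lab_curve idx_less by fastforce
      next
        case 2
        then show ?thesis by (simp add: lab_axis)
      next
        case 3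
        then show ?thesis using lab_plane[of d] by simp
      qed
    qed
    have "(0::nat) < 5" by simp
    note card = card_curves_axis[OF finG G(3) this]
    have "inj_on plane D" by (auto simp: inj_on_def plane_def)
    then have cD: "card (plane ` D) = 51" using D(2) by (simp add: card_image)
    then have fD: "finite (plane ` D)" by (intro card_ge_0_finite) simp
    have d1: "curves 5 b G \<inter> axis 5 = {}"
      using G(3) by (auto simp: curves_def curve_def axis_def)
    have d2: "(curves 5 b G \<union> axis 5) \<inter> plane ` D = {}"
      using G(3) D(3) by (auto simp: curves_def curve_def axis_def plane_def zero_prod_def)
    have "card (curves 5 b G \<union> axis 5) = 23 * 2 ^ 5 + (2 ^ 5 - 1)"
      using card_Un_disjoint[OF card(1,2) d1] card(3,4) G(2) by simp
    then show "card B = 818"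
      unfolding B_def using card_Un_disjoint[OF finite_UnI[OF card(1,2)] fD d2] cD by simp
    show "cover23 (bvec 11 \<times> gf 5 \<times> gf 5 \<times> gf 5) B lab"
      unfolding cover23_def
    proof (intro conjI ballI)
      show "finite B" unfolding B_def using card(1,2) fD by simp
      show "B \<subseteq> bvec 11 \<times> gf 5 \<times> gf 5 \<times> gf 5"
        unfolding B_def using curves_axis_subset[OF G(1), of b 5] b_gf(1) D(1)
        by (auto simp: plane_def bvec_def)
      fix v assume "v \<in> bvec 11 \<times> gf 5 \<times> gf 5 \<times> gf 5"
      then obtain p u1 u2 u3 where v: "v = (p, u1, u2, u3)" and p: "p \<in> bvec 11"
        and u: "u1 \<in> gf 5" "u2 \<in> gf 5" "u3 \<in> gf 5" by auto
      let ?goal = "\<exists>T\<subseteq>B. card T \<in> {2, 3} \<and> \<Sum>T = v \<and> inj_on lab T"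
      have ex2: ?goal if "x \<in> B" "y \<in> B" "lab x \<noteq> lab y" "x + y = v" for x y
        using inj_on_two[OF that(3)] that by (intro exI[of _ "{x, y}"]) simp
      have ex3: ?goal if "x \<in> B" "y \<in> B" "z \<in> B" "lab x \<noteq> lab y" "lab x \<noteq> lab z" "lab y \<noteq> lab z"
        "x + y + z = v" for x y z
        using inj_on_three[OF that(4-6)] that by (intro exI[of _ "{x, y, z}"]) simp
      consider (0) "p = 0" | (1) "p \<in> G" | (2) T where "T \<subseteq> G" "card T \<in> {2, 3}" "\<Sum>T = p"
        using golay[OF p] by blast
      then show ?goal
      proof cases
        case 2
        have "inj_on b T" using b_inj 2(1) by (rule inj_on_subset)
        moreover have "b ` G \<subseteq> gf 5" using b_gf by blast
        ultimately obtain S where S: "S \<subseteq> curves 5 b G \<union> axis 5" "card S \<in> {2, 3}"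
          "\<Sum>S = v" "inj_on fst S"
          using sum_curves[OF 2(1,2) _ G(3) _ u] 2(3) v by metis
        \<comment> \<open>Curve labels are below 23 and determine the Golay column; axis labels are
          at least 34. So equal labels force equal first components, which \<open>S\<close> does not
          repeat.\<close>
        have "inj_on lab S"
        proof (rule inj_onI)
          fix s t assume st: "s \<in> S" "t \<in> S" "lab s = lab t"
          have mem: "(fst q \<in> G \<and> lab q = idx (fst q)) \<or> (fst q = 0 \<and> lab q \<ge> 34)" if "q \<in> S" for q
          proof -
            have "q \<in> curves 5 b G \<or> q \<in> axis 5" using S(1) that by blast
            then show ?thesis
              using lab_curve[unfolded curve_def]
              by (auto simp: curves_def axis_def curve_def lab_axis_ge)
          qed
          have "fst s = fst t"
            using mem[OF st(1)] mem[OF st(2)] st(3) idx_less[of "fst s"] idx_less[of "fst t"] idx_inj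
            by auto
          then show "s = t" using S(4) st by (auto dest: inj_onD)
        qed
        then show ?thesis using S unfolding B_def by blast
      next
        case 1
        \<comment> \<open>This makes the last coordinate of the curve point over \<open>p\<close>
          equal to \<open>u3\<close>, so the remainder lies in the plane of
          \<open>D\<close>.\<close>
        define x where "x = u3 / (b p)\<^sup>2"
        have x: "x \<in> gf 5" unfolding x_def using u b_gf by (intro gf_divide gf_power)
        have x3: "(b p)\<^sup>2 * x = u3" using b_gf(2)[of p] by (simp add: x_def)
        define y where "y = (u1 + x, u2 + b p * x)"
        have y: "y \<in> gf 5 \<times> gf 5" using u x b_gf(1)[of p] by (auto simp: y_def)
        have vy: "v = curve b p x + plane y"
          using x3 by (simp add: v curve_def plane_def y_def add.commute)
        show ?thesis
        proof (cases "y = 0")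
          case False
          then obtain d e where de: "d \<in> D" "e \<in> D" "cl d \<noteq> cl e" "y = d + e"
            using two[OF y] by blast
          show ?thesis
          proof (rule ex3[of "curve b p x" "plane d" "plane e"])
            show "curve b p x + plane d + plane e = v"
              unfolding vy de(4) plane_add by (simp only: add.assoc)
          qed (use de 1 x B_curve B_plane lab_plane[OF de(1)] lab_plane[OF de(2)] lab_curve[OF 1] idx_less[OF 1] in auto)
        next
          case True
          \<comment> \<open>Here \<open>v\<close> is itself a curve point. It is moved along its
            curve by \<open>s\<close>; a point of \<open>D\<close> with slope \<open>b p\<close> and
            an axis vector undo the move.\<close>
          obtain s where s: "s \<in> gf 5" "s \<noteq> 0" "(s, b p * s) \<in> D"
            using slope[OF idx_less[OF 1]] by (auto simp: b_def)
          have w: "(b p)\<^sup>2 * s \<in> gf 5" "(b p)\<^sup>2 * s \<noteq> 0"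
            using s b_gf by auto
          show ?thesis
          proof (rule ex3[of "curve b p (x + s)" "plane (s, b p * s)" "(0, 0, 0, (b p)\<^sup>2 * s)"])
            show "curve b p (x + s) + plane (s, b p * s) + (0, 0, 0, (b p)\<^sup>2 * s) = v"
              unfolding vy True by (simp add: curve_def plane_def zero_prod_def algebra_simps)
            show "lab (plane (s, b p * s)) \<noteq> lab (0, 0, 0, (b p)\<^sup>2 * s)"
              using lab_plane[OF s(3)] by (simp only: lab_axis split: if_splits) arith
          qed (use s 1 x w B_curve B_plane B_axis lab_plane[OF s(3)] lab_curve[OF 1] idx_less[OF 1] lab_axis in auto)
        qed
      next
        case 0
        show ?thesis
        proof (cases "(u1, u2) = 0")
          case False
          then obtain d e where de: "d \<in> D" "e \<in> D" "cl d \<noteq> cl e" "(u1, u2) = d + e"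
            using two[of "(u1, u2)"] u by blast
          have vde: "v = plane d + plane e + (0, 0, 0, u3)"
            using de(4) 0 v by (simp add: plane_def plus_prod_def)
          show ?thesis
          proof (cases "u3 = 0")
            case True
            show ?thesis
              by (rule ex2[of "plane d" "plane e"])
                (use de B_plane lab_plane vde True in \<open>auto simp: zero_prod_def[symmetric]\<close>)
          next
            case False
            show ?thesis
              by (rule ex3[of "plane d" "plane e" "(0, 0, 0, u3)"])
                (use de B_plane B_axis u False lab_plane[OF de(1)] lab_plane[OF de(2)] lab_axis[of u3] vde in auto)
          qed
        next
          case True
          have v': "v = (0, 0, 0, u3)" using 0 True v by (simp add: zero_prod_def)
          \<comment> \<open>The elements \<open>1\<close>, \<open>a\<close>, \<open>1 + a\<close>
            have sum zero and lie in the three different axis classes. Any \<open>u3\<close> other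
            than these and zero equals \<open>1 + (1 + u3)\<close>, with second summand in the third
            class.\<close>
          have one_a: "1 + a \<noteq> 0" "1 + a \<noteq> 1" "1 + a \<noteq> a" "1 + a \<in> gf 5" using a a1 by auto
          consider "u3 = 0" | "u3 = 1" | "u3 = a" | "u3 = 1 + a" | "u3 \<noteq> 0" "u3 \<noteq> 1" "u3 \<noteq> a" "u3 \<noteq> 1 + a" by blast
          then show ?thesis
          proof cases
            case 1
            show ?thesis
              by (rule ex3[of "(0, 0, 0, 1)" "(0, 0, 0, a)" "(0, 0, 0, 1 + a)"])
                (use a a1 one_a B_axis lab_axis v' 1 in auto)
          next
            case 2
            show ?thesis
              by (rule ex2[of "(0, 0, 0, a)" "(0, 0, 0, 1 + a)"])
                (use a a1 one_a B_axis lab_axis v' 2 in \<open>auto simp: algebra_simps\<close>)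
          next
            case 3
            show ?thesis
              by (rule ex2[of "(0, 0, 0, 1)" "(0, 0, 0, 1 + a)"])
                (use a a1 one_a B_axis lab_axis v' 3 in auto)
          next
            case 4
            show ?thesis
              by (rule ex2[of "(0, 0, 0, 1)" "(0, 0, 0, a)"])
                (use a a1 one_a B_axis lab_axis v' 4 in auto)
          next
            case 5
            have w: "1 + u3 \<in> gf 5" "1 + u3 \<noteq> 0" "1 + u3 \<noteq> 1" "1 + u3 \<noteq> a"
              using u 5 by auto
            show ?thesis
              by (rule ex2[of "(0, 0, 0, 1)" "(0, 0, 0, 1 + u3)"])
                (use w B_axis lab_axis v' in auto)
          qed
        qed
      qed
    qed
  qed
qed

section \<open>The infinite family\<close>

lemma start_code:
  obtains C :: "(nat \<Rightarrow> bit) set" and c :: "(nat \<Rightarrow> bit) \<Rightarrow> nat"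
  where "cover23 (bvec 26) C c" "card C = 818" "0 \<notin> C" "c ` C \<subseteq> {..<37}"
proof -
  let ?V = "bvec 11 \<times> gf 5 \<times> gf 5 \<times> gf 5"
  obtain B :: "((nat \<Rightarrow> bit) \<times> f2bar \<times> f2bar \<times> f2bar) set" and lab :: "(nat \<Rightarrow> bit) \<times> f2bar \<times> f2bar \<times> f2bar \<Rightarrow> nat"
    where B: "cover23 ?V B lab" "card B = 818" "0 \<notin> B" "lab ` B \<subseteq> {..<37}"
    by (rule start_cover) (rule that)
  have V: "elem2 ?V 26" using elem2_total[of 5 11] by simp
  obtain \<phi> where \<phi>: "bij_betw \<phi> ?V (bvec 26)"
    "\<And>x y. x \<in> ?V \<Longrightarrow> y \<in> ?V \<Longrightarrow> \<phi> (x + y) = \<phi> x + \<phi> y"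
    by (rule elem2_iso_bvec[OF V]) (rule that)
  have sub: "B \<subseteq> ?V" using B(1) by (simp add: cover23_def)
  have inj: "inj_on \<phi> ?V" using \<phi>(1) by (rule bij_betw_imp_inj_on)
  show ?thesis
  proof (rule that)
    show "cover23 (bvec 26) (\<phi> ` B) (\<lambda>w. lab (the_inv_into ?V \<phi> w))"
      by (rule cover23_image[OF V B(1) \<phi>(1)]) (rule \<phi>(2))
    show "card (\<phi> ` B) = 818"
      using B(2) card_image[OF inj_on_subset[OF inj sub]] by simp
    have z: "0 \<in> ?V" using V by (simp add: elem2_def)
    then have z': "\<phi> 0 = 0" using \<phi>(2)[OF z z] by simp
    show "0 \<notin> \<phi> ` B"
    proof
      assume "0 \<in> \<phi> ` B"
      then obtain x where x: "x \<in> B" "\<phi> x = \<phi> 0" unfolding z' by (metis imageE)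
      then have "x = 0" using inj_onD[OF inj x(2) _ z] sub by blast
      then show False using B(3) x(1) by blast
    qed
    show "(\<lambda>w. lab (the_inv_into ?V \<phi> w)) ` \<phi> ` B \<subseteq> {..<37}"
    proof (intro image_subsetI)
      fix w assume "w \<in> \<phi> ` B"
      then obtain x where x: "x \<in> B" "w = \<phi> x" by blast
      have "the_inv_into ?V \<phi> w = x"
        unfolding x(2) using sub x(1) by (intro the_inv_into_f_f[OF inj]) blast
      then show "lab (the_inv_into ?V \<phi> w) \<in> {..<37}" using B(4) x(1) by blast
    qed
  qed
qed

text \<open>For \<open>t = 9\<close> the starting code itself is meant. Otherwise
  \<open>m = t - 9\<close> must give \<open>37 \<le> 2 ^ m\<close>, that is
  \<open>m \<ge> 6\<close>, whence the bound 15. The factor 819 is 818 + 1.\<close>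

lemma code_family:
  assumes "t = 9 \<or> t \<ge> 15"
  shows "\<exists>H. is_code_Rl (819 * 2 ^ (t - 9) - 1) (3 * t - 1) 3 3 2 H"
proof -
  obtain C :: "(nat \<Rightarrow> bit) set" and c :: "(nat \<Rightarrow> bit) \<Rightarrow> nat"
    where C: "cover23 (bvec 26) C c" "card C = 818" "0 \<notin> C" "c ` C \<subseteq> {..<37}"
    by (rule start_code) (rule that)
  show ?thesis
  proof (cases "t = 9")
    case True
    then show ?thesis using code_of_cover23[OF C(1-3)] by simp
  next
    case False
    define m where "m = t - 9"
    have m: "m \<ge> 6" "3 * t - 1 = 26 + 3 * m" using assms False by (auto simp: m_def)
    have "2 ^ 6 \<le> (2::nat) ^ m" using m(1) by (rule power_increasing) simp
    then have "{..<37} \<subseteq> {..<(2::nat) ^ m}" by auto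
    then have lab: "c ` C \<subseteq> {..<2 ^ m}" by (rule order_trans[OF C(4)])
    have len: "819 * 2 ^ m - 1 = (card C + 1) * 2 ^ m - (1::nat)" unfolding C(2) by simp
    have "819 * 2 ^ m - 1 + 1 = 819 * (2::nat) ^ m" by simp
    then have "(819 * 2 ^ m - 1 + 1)\<^sup>2 = 819\<^sup>2 * ((2::nat) ^ m)\<^sup>2"
      by (simp only: power_mult_distrib)
    also have "\<dots> < 2 ^ 26 * ((2::nat) ^ m)\<^sup>2" by (rule mult_strict_right_mono) simp_all
    also have "\<dots> = 2 ^ (26 + 2 * m)" by (simp only: power_add power_even_eq)
    also have "\<dots> \<le> 2 ^ (26 + 3 * m)" by (rule power_increasing) simp_all
    finally have "(819 * 2 ^ m - 1 + 1)\<^sup>2 < (2::nat) ^ (26 + 3 * m)" .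
    moreover have "m > 0" using m(1) by simp
    ultimately show ?thesis
      unfolding m(2) m_def[symmetric] by (intro code_curves[OF C(1,3) _ lab len])
  qed
qed

lemma ell2_le: "is_code_Rl n r d R l H \<Longrightarrow> ell2 r R \<le> n"
  unfolding ell2_def is_code_Rl_def by (intro Least_le) blast

section \<open>The limit of the covering density\<close>

lemma sum_binomials_3:
  "(\<Sum>i\<le>3. real (n choose i)) =
    1 + real n + real n * (real n - 1) / 2 + real n * (real n - 1) * (real n - 2) / 6"
proof -
  have "real (n choose i) = (\<Prod>j<i. real n - real j) / fact i" for i
    by (simp add: binomial_gbinomial gbinomial_prod_rev lessThan_atLeast0)
  then show ?thesis
    by (simp add: numeral_3_eq_3 numeral_2_eq_2 fact_numeral)
qed

text \<open>With \<open>y = (1 / 2) ^ m\<close> and \<open>t = m + 9\<close> the density is a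
  polynomial \<open>g y\<close>, because \<open>n = (819 - y) / y\<close>. Its value at zero is
  \<open>819 ^ 3 / (6 * 2 ^ 26)\<close>.\<close>

lemma density_limit:
  "(\<lambda>t::nat. (\<Sum>i\<le>3. real ((819 * 2 ^ (t - 9) - 1) choose i)) / 2 ^ (3 * t - 1))
      \<longlonglongrightarrow> 819 ^ 3 / (3 * 2 ^ 27)" (is "?f \<longlonglongrightarrow> ?l")
proof -
  define g :: "real \<Rightarrow> real" where
    "g y = (y ^ 3 + (819 - y) * y\<^sup>2 + (819 - y) * (819 - 2 * y) * y / 2
        + (819 - y) * (819 - 2 * y) * (819 - 3 * y) / 6) / 2 ^ 26" for y
  have f_eq: "?f (m + 9) = g ((1 / 2) ^ m)" for m
  proof -
    define x :: real where "x = 2 ^ m"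
    have x: "x > 0" "(1 / 2) ^ m = 1 / x" by (simp_all add: x_def power_divide)
    have "(1::nat) \<le> 2 ^ m" by simp
    then have "(1::nat) \<le> 819 * 2 ^ m" by linarith
    then have n: "real (819 * 2 ^ m - 1) = 819 * x - 1"
      by (simp add: x_def of_nat_diff)
    have e: "3 * (m + 9) - 1 = 26 + m * 3" by simp
    have den: "(2::real) ^ (3 * (m + 9) - 1) = 2 ^ 26 * x ^ 3"
      unfolding e by (simp only: power_add power_mult x_def)
    show ?thesis
      unfolding den g_def x(2) add_diff_cancel_right' sum_binomials_3 n
      using x(1) by (simp add: field_simps power2_eq_square power3_eq_cube)
  qed
  have "(\<lambda>m. (1 / 2 :: real) ^ m) \<longlonglongrightarrow> 0"
    by (rule LIMSEQ_power_zero) simp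
  moreover have "isCont g 0" unfolding g_def by (intro continuous_intros) simp_all
  ultimately have "(\<lambda>m. g ((1 / 2) ^ m)) \<longlonglongrightarrow> g 0"
    by (rule isCont_tendsto_compose[rotated])
  then have "(\<lambda>m. ?f (m + 9)) \<longlonglongrightarrow> ?l"
    unfolding f_eq by (simp add: g_def)
  then show ?thesis by (rule LIMSEQ_offset)
qed

theorem theorem7p6:
  shows "(\<forall>t::nat. (t = 9 \<or> t \<ge> 15) \<longrightarrow>
            (let r = 3 * t - 1; n = 819 * 2 ^ (t - 9) - 1 in
               (\<exists>H. is_code_Rl n r 3 3 2 H) \<and> ell2 r 3 \<le> n))
       \<and> (\<lambda>t::nat. (\<Sum>i\<le>3. real ((819 * 2 ^ (t - 9) - 1) choose i)) / 2 ^ (3 * t - 1))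
            \<longlonglongrightarrow> 819 ^ 3 / (3 * 2 ^ 27)"
proof (intro conjI allI impI density_limit)
  fix t :: nat assume "t = 9 \<or> t \<ge> 15"
  then obtain H where "is_code_Rl (819 * 2 ^ (t - 9) - 1) (3 * t - 1) 3 3 2 H"
    using code_family by blast
  then show "let r = 3 * t - 1; n = 819 * 2 ^ (t - 9) - 1 in
      (\<exists>H. is_code_Rl n r 3 3 2 H) \<and> ell2 r 3 \<le> n"
    unfolding Let_def using ell2_le by blast
qed

end
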